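(* Assume (A1)–(A4) and fix $\delta>0$. For each $m\in\mathbb N$ let $\lambda^m_\delta$ be the constant of a solution $(w^m_\delta,\lambda^m_\delta)$ of the one-step equation (OS) on $B_m$ (such solutions exist, and $\lambda^m_\delta$ equals the optimal value of the dyadic impulse control problem with obligatory impulses outside $B_m$, hence is uniquely determined and non-decreasing in $m$), and set $\lambda_\delta:=\lim_{m\to\infty}\lambda^m_\delta$. If $\lambda_\delta>r(f)$, then there exists $w_\delta\in\mathcal C_b(E)$ with $\sup_{\xi\in U}w_\delta(\xi)=0$ such that \[ w_\delta(x)=\sup_{\tau\in\mathcal T^\delta_{x,b}}\ln\mathbb E_x\Big[e^{\int_0^\tau(f(X_s)-\lambda_\delta)ds+Mw_\delta(X_\tau)}\Big],\qquad x\in E. \]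
   Context: Setting: $X$ is a standard Feller–Markov process with values in a locally compact separable metric space $(E,\rho)$ with Borel $\sigma$-field $\mathcal E$; laws $\mathbb P_x$, expectations $\mathbb E_x$, $P_t(x,A)=\mathbb P_x[X_t\in A]$. $\mathcal C_b(E)$: bounded continuous functions. $\mathcal T^\delta_{x,b}$: $\mathbb P_x$-a.s. bounded stopping times with values in $\{0,\delta,2\delta,\dots\}\cup\{\infty\}$. $U\subseteq E$ compact; $(B_m)$ compact, $U\subset B_0$, $B_m\subset B_{m+1}$, $\bigcup B_m=E$. $Mh(x):=\sup_{\xi\in U}(c(x,\xi)+h(\xi))$. $r(f):=\lim_{t\to\infty}\frac1t\ln\sup_{x\in E}\mathbb E_x[e^{\int_0^tf(X_s)ds}]$. $\tau_{B_m}:=\delta\inf\{k\in\mathbb N:X_{k\delta}\notin B_m\}$. (OS) on $B_m$: $\lambda^m_\delta\in\mathbb R$, $w^m_\delta$ bounded continuous on $B_m$, $w^m_\delta=Mw^m_\delta$ off $B_m$, and for $x\in B_m$: $w^m_\delta(x)=\max\big(\ln\mathbb E_x[e^{\int_0^\delta(f(X_s)-\lambda^m_\delta)ds+1_{\{X_\delta\in B_m\}}w^m_\delta(X_\delta)+1_{\{X_\delta\notin B_m\}}Mw^m_\delta(X_\delta)}],\ Mw^m_\delta(x)\big)$. Standing assumptions: (A1) $f:E\to(-\infty,0]$ is continuous and bounded; $c:E\times U\to(-\infty,0]$ is continuous, bounded, and for some $c_0<0$: $0>c_0\ge c(x,\xi)\ge c(x,\eta)+c(\eta,\xi)$ for all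 $x\in E$, $\xi,\eta\in U$; moreover $\sup_{\xi\in U}|c(x,\xi)-c(y,\xi)|\to0$ as $x,y$ both tend to infinity (leave every compact set). (A2) For every $t>0$ and $x_n\to x$: $\sup_{A\in\mathcal E}|P_t(x_n,A)-P_t(x,A)|\to0$. (A3) For every compact $\Gamma\subset E$, $t_0>0$, $r_0>0$: $\lim_{r\to\infty}M_\Gamma(t_0,r)=0$ and $\lim_{t\to0}M_\Gamma(t,r_0)=0$, where $M_\Gamma(t,r):=\sup_{x\in\Gamma}\mathbb P_x[\sup_{s\in[0,t]}\rho(X_s,x)\ge r]$. (A4) For every $m$, $x\in B_m$, $\delta>0$ and open $\mathcal O\subset B_m$: $\mathbb P_x[\bigcup_{i\ge1}\{X_{i\delta}\in\mathcal O\}]=1$; and for all $x\in E$, $\delta>0$, $m$: $\mathbb P_x[\tau_{B_m}<\infty]=1$. *)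

theory Defs
  imports "HOL-Probability.Probability"
begin

text \<open>Common measurable path space M, laws Px x, process X (time real, t \<ge> 0).\<close>

definition natfilt :: "'w measure \<Rightarrow> (real \<Rightarrow> 'w \<Rightarrow> 'a::topological_space) \<Rightarrow> real \<Rightarrow> 'w measure" where
  "natfilt M X t = sigma (space M)
     {X s -` A \<inter> space M | s A. s \<in> {0..t} \<and> A \<in> sets borel}"

definition Ptrans :: "('a \<Rightarrow> 'w measure) \<Rightarrow> (real \<Rightarrow> 'w \<Rightarrow> 'a) \<Rightarrow> real \<Rightarrow> 'a \<Rightarrow> 'a set \<Rightarrow> real" where
  "Ptrans Px X t x A = measure (Px x) {\<omega> \<in> space (Px x). X t \<omega> \<in> A}"

definition C0 :: "('a::metric_space \<Rightarrow> real) set" where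
  "C0 = {g. continuous_on UNIV g \<and>
            (\<forall>\<epsilon>>0. \<exists>K. compact K \<and> (\<forall>x. x \<notin> K \<longrightarrow> \<bar>g x\<bar> \<le> \<epsilon>))}"

definition Cb :: "('a::metric_space \<Rightarrow> real) set" where
  "Cb = {g. continuous_on UNIV g \<and> bounded (range g)}"

definition standard_Feller_Markov ::
  "'w measure \<Rightarrow> ('a::metric_space \<Rightarrow> 'w measure) \<Rightarrow> (real \<Rightarrow> 'w \<Rightarrow> 'a) \<Rightarrow> bool" where
  "standard_Feller_Markov M Px X \<longleftrightarrow>
     (\<forall>x. prob_space (Px x) \<and> sets (Px x) = sets M) \<and>
     (\<forall>t\<ge>0. X t \<in> measurable M borel) \<and>
     (\<forall>x. AE \<omega> in Px x. X 0 \<omega> = x) \<and>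
     (\<forall>\<omega>\<in>space M. \<forall>t\<ge>0. continuous (at_right t) (\<lambda>s. X s \<omega>) \<and>
        (t > 0 \<longrightarrow> (\<exists>l. ((\<lambda>s. X s \<omega>) \<longlongrightarrow> l) (at_left t)))) \<and>
     (\<forall>x s t A F. 0 \<le> s \<longrightarrow> 0 \<le> t \<longrightarrow> A \<in> sets borel \<longrightarrow> F \<in> sets (natfilt M X s) \<longrightarrow>
        integral\<^sup>L (Px x) (\<lambda>\<omega>. indicator F \<omega> * indicator A (X (s + t) \<omega>)) =
        integral\<^sup>L (Px x) (\<lambda>\<omega>. indicator F \<omega> * Ptrans Px X t (X s \<omega>) A)) \<and>
     (\<forall>g\<in>C0. \<forall>t\<ge>0. (\<lambda>x. integral\<^sup>L (Px x) (\<lambda>\<omega>. g (X t \<omega>))) \<in> C0) \<and>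
     (\<forall>g\<in>C0. \<forall>x. ((\<lambda>t. integral\<^sup>L (Px x) (\<lambda>\<omega>. g (X t \<omega>))) \<longlongrightarrow> g x) (at_right 0))"

definition Mop :: "('a \<Rightarrow> 'a \<Rightarrow> real) \<Rightarrow> 'a set \<Rightarrow> ('a \<Rightarrow> real) \<Rightarrow> 'a \<Rightarrow> real" where
  "Mop c U h x = (SUP \<xi>\<in>U. c x \<xi> + h \<xi>)"

definition rate :: "('a \<Rightarrow> 'w measure) \<Rightarrow> (real \<Rightarrow> 'w \<Rightarrow> 'a) \<Rightarrow> ('a \<Rightarrow> real) \<Rightarrow> real" where
  "rate Px X f = Lim at_top (\<lambda>t. ln (SUP x. integral\<^sup>L (Px x)
        (\<lambda>\<omega>. exp (integral {0..t} (\<lambda>s. f (X s \<omega>))))) / t)"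

text \<open>Dyadic a.s. bounded stopping times T^delta_{x,b}; a stopping time is encoded by
  its multiplier sigma (tau = sigma * delta, sigma = \<infinity> meaning tau = \<infinity>).\<close>
definition dyadic_stopping_times ::
  "'w measure \<Rightarrow> ('a \<Rightarrow> 'w measure) \<Rightarrow> (real \<Rightarrow> 'w \<Rightarrow> 'a::topological_space) \<Rightarrow> real \<Rightarrow> 'a \<Rightarrow> ('w \<Rightarrow> enat) set" where
  "dyadic_stopping_times M Px X \<delta> x =
     {\<sigma>. (\<forall>k::nat. {\<omega> \<in> space M. \<sigma> \<omega> = enat k} \<in> sets (natfilt M X (real k * \<delta>))) \<and>
          (\<exists>N::nat. AE \<omega> in Px x. \<sigma> \<omega> \<le> enat N)}"

definition OS_solution ::
  "('a \<Rightarrow> 'w measure) \<Rightarrow> (real \<Rightarrow> 'w \<Rightarrow> 'a::metric_space) \<Rightarrow> ('a \<Rightarrow> real) \<Rightarrow> ('a \<Rightarrow> 'a \<Rightarrow> real) \<Rightarrow>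
     'a set \<Rightarrow> real \<Rightarrow> 'a set \<Rightarrow> real \<Rightarrow> ('a \<Rightarrow> real) \<Rightarrow> bool" where
  "OS_solution Px X f c U \<delta> B lam w \<longleftrightarrow>
     bounded (w ` B) \<and> continuous_on B w \<and>
     (\<forall>x. x \<notin> B \<longrightarrow> w x = Mop c U w x) \<and>
     (\<forall>x\<in>B. w x = max
        (ln (integral\<^sup>L (Px x) (\<lambda>\<omega>. exp (integral {0..\<delta>} (\<lambda>s. f (X s \<omega>) - lam)
             + (if X \<delta> \<omega> \<in> B then w (X \<delta> \<omega>) else Mop c U w (X \<delta> \<omega>))))))
        (Mop c U w x))"

definition A1 :: "('a::metric_space \<Rightarrow> real) \<Rightarrow> ('a \<Rightarrow> 'a \<Rightarrow> real) \<Rightarrow> 'a set \<Rightarrow> bool" where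
  "A1 f c U \<longleftrightarrow>
     continuous_on UNIV f \<and> bounded (range f) \<and> (\<forall>x. f x \<le> 0) \<and>
     continuous_on (UNIV \<times> U) (\<lambda>(x, \<xi>). c x \<xi>) \<and> bounded ((\<lambda>(x, \<xi>). c x \<xi>) ` (UNIV \<times> U)) \<and>
     (\<forall>x. \<forall>\<xi>\<in>U. c x \<xi> \<le> 0) \<and>
     (\<exists>c0<0. \<forall>x. \<forall>\<xi>\<in>U. \<forall>\<eta>\<in>U. c0 \<ge> c x \<xi> \<and> c x \<xi> \<ge> c x \<eta> + c \<eta> \<xi>) \<and>
     (\<forall>\<epsilon>>0. \<exists>K. compact K \<and>
        (\<forall>x y. x \<notin> K \<longrightarrow> y \<notin> K \<longrightarrow> (\<forall>\<xi>\<in>U. \<bar>c x \<xi> - c y \<xi>\<bar> \<le> \<epsilon>)))"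

definition A2 :: "('a::metric_space \<Rightarrow> 'w measure) \<Rightarrow> (real \<Rightarrow> 'w \<Rightarrow> 'a) \<Rightarrow> bool" where
  "A2 Px X \<longleftrightarrow> (\<forall>t>0. \<forall>x xn. xn \<longlonglongrightarrow> x \<longrightarrow>
     (\<lambda>n. SUP A\<in>sets borel. \<bar>Ptrans Px X t (xn n) A - Ptrans Px X t x A\<bar>) \<longlonglongrightarrow> 0)"

definition MGamma :: "('a::metric_space \<Rightarrow> 'w measure) \<Rightarrow> (real \<Rightarrow> 'w \<Rightarrow> 'a) \<Rightarrow> 'a set \<Rightarrow> real \<Rightarrow> real \<Rightarrow> real" where
  "MGamma Px X \<Gamma> t r = (SUP x\<in>\<Gamma>. measure (Px x)
      {\<omega> \<in> space (Px x). (SUP s\<in>{0..t}. dist (X s \<omega>) x) \<ge> r})"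

definition A3 :: "('a::metric_space \<Rightarrow> 'w measure) \<Rightarrow> (real \<Rightarrow> 'w \<Rightarrow> 'a) \<Rightarrow> bool" where
  "A3 Px X \<longleftrightarrow> (\<forall>\<Gamma> t0 r0. compact \<Gamma> \<longrightarrow> \<Gamma> \<noteq> {} \<longrightarrow> t0 > 0 \<longrightarrow> r0 > 0 \<longrightarrow>
     ((\<lambda>r. MGamma Px X \<Gamma> t0 r) \<longlongrightarrow> 0) at_top \<and>
     ((\<lambda>t. MGamma Px X \<Gamma> t r0) \<longlongrightarrow> 0) (at_right 0))"

definition A4 :: "('a::metric_space \<Rightarrow> 'w measure) \<Rightarrow> (real \<Rightarrow> 'w \<Rightarrow> 'a) \<Rightarrow> (nat \<Rightarrow> 'a set) \<Rightarrow> bool" where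
  "A4 Px X B \<longleftrightarrow>
     (\<forall>m x \<delta> V. x \<in> B m \<longrightarrow> \<delta> > 0 \<longrightarrow> open V \<longrightarrow> V \<noteq> {} \<longrightarrow> V \<subseteq> B m \<longrightarrow>
        measure (Px x) {\<omega> \<in> space (Px x). \<exists>i::nat. i \<ge> 1 \<and> X (real i * \<delta>) \<omega> \<in> V} = 1) \<and>
     (\<forall>x \<delta> m. \<delta> > 0 \<longrightarrow>
        measure (Px x) {\<omega> \<in> space (Px x). \<exists>k::nat. X (real k * \<delta>) \<omega> \<notin> B m} = 1)"

end

theory Submission
  imports Defs "HOL-Complex_Analysis.Great_Picard"
begin

text \<open>
  Write \<open>T\<close> for the Feynman-Kac operator
  \<open>T \<phi> (x) = E\<^sub>x [exp (\<integral>\<^sub>0\<^sup>\<delta> f (X\<^sub>s) ds) \<phi> (X\<^sub>\<delta>)]\<close>. Normalise the given solutions so that their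
  suprema over \<open>U\<close> vanish. Since eventually \<open>\<lambda>\<^sup>m\<close> stays above the growth rate \<open>r(f)\<close>,
  iterating \<open>e\<^sup>w \<le> 1 + exp (- \<lambda>\<^sup>m \<delta>) T e\<^sup>w\<close> bounds them uniformly in \<open>m\<close>. By (A2) the operator \<open>T\<close>
  maps bounded families of Borel functions to equicontinuous families, so the right-hand sides of
  the one-step equations, which agree with the solutions on \<open>B\<^sub>m\<close>, have a subsequence converging
  pointwise on \<open>E\<close> and uniformly on \<open>U\<close>. The limit \<open>w\<close> is bounded and continuous and satisfies
  \<open>w = max (ln (T e\<^sup>w) - \<lambda> \<delta>) (M w)\<close> on all of \<open>E\<close>. A supermartingale argument, together with
  stopping the first time \<open>w = M w\<close>, capped at a large deterministic time, identifies \<open>w\<close> with the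
  value of the stopping problem; the error of the cap vanishes because \<open>\<lambda> > r(f)\<close>.
\<close>

subsection \<open>Real analysis\<close>

text \<open>The Markov property of the process speaks of a single future time and there are no shift
  operators, so the weight given by the path integral of \<open>f\<close> cannot be conditioned
  directly. Paths are right-continuous and \<open>f\<close> is continuous, so this integral is a
  limit of Riemann sums at right endpoints. For such sums conditioning proceeds grid point by grid
  point, and since \<open>f\<close> is non-positive all weights are at most 1 and dominated
  convergence carries the result over to \<open>T\<close>.

  Two obstacles shape the limit in \<open>m\<close>. A solution on \<open>B m\<close> is known to be
  continuous on \<open>B m\<close> but not across its boundary; this is why compactness is applied
  to the right-hand sides, which make sense on the whole space. And no uniform convergence on the
  whole space is available: \<open>T\<close> needs only bounded pointwise convergence, while
  \<open>Mop\<close>, a supremum, needs uniformity, but only on \<open>U\<close>. The uniform lower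
  bound of the solutions is an effect of the normalisation: if the supremum of \<open>w\<close> over
  \<open>U\<close> is 0, then \<open>Mop\<close> of \<open>w\<close> is at least the lower bound of
  \<open>c\<close>.\<close>

lemma step_function_has_integral:
  fixes h :: "real \<Rightarrow> real"
  assumes d: "d > 0"
  shows "((\<lambda>u. h (a + d * of_int \<lceil>(u - a) / d\<rceil>)) has_integral
    (d * (\<Sum>i=1..n. h (a + real i * d)))) {a..a + real n * d}"
proof (induction n)
  case 0
  then show ?case by (simp add: has_integral_refl)
next
  case (Suc n)
  have "((\<lambda>u. h (a + real (Suc n) * d)) has_integral (d * h (a + real (Suc n) * d)))
      {a + real n * d..a + real (Suc n) * d}"
    using has_integral_const_real[of "h (a + real (Suc n) * d)" "a + real n * d" "a + real (Suc n) * d"] d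
    by (simp add: algebra_simps)
  then have "((\<lambda>u. h (a + d * of_int \<lceil>(u - a) / d\<rceil>)) has_integral (d * h (a + real (Suc n) * d)))
      {a + real n * d..a + real (Suc n) * d}"
  \<comment> \<open>At the left end of the cell the ceiling still selects the previous grid point; a
    single exceptional point does not affect the integral.\<close>
  proof (rule has_integral_spike_finite[rotated 2])
    fix u assume "u \<in> {a + real n * d..a + real (Suc n) * d} - {a + real n * d}"
    then have "real n < (u - a) / d" "(u - a) / d \<le> real n + 1"
      using d by (auto simp: field_simps)
    then have "\<lceil>(u - a) / d\<rceil> = int (Suc n)"
      by (intro ceiling_unique) auto
    then show "h (a + d * of_int \<lceil>(u - a) / d\<rceil>) = h (a + real (Suc n) * d)"
      by (simp add: algebra_simps)
  qed simp
  from has_integral_combine[OF _ _ Suc.IH this] d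
  show ?case by (simp add: algebra_simps)
qed

text \<open>Rounding \<open>u\<close> up to the grid approaches \<open>u\<close> from the right, so
  right-continuity suffices for the step functions to converge pointwise. Dominated convergence for
  the gauge integral then delivers integrability of \<open>h\<close> together with the
  limit.\<close>

lemma right_continuous_riemann_sums:
  fixes h :: "real \<Rightarrow> real"
  assumes t: "t \<ge> 0"
    and rc: "\<And>u. u \<in> {a..a + t} \<Longrightarrow> continuous (at_right u) h"
    and bd: "\<And>u. u \<in> {a..a + t} \<Longrightarrow> \<bar>h u\<bar> \<le> C"
  shows "h integrable_on {a..a + t}"
    and "(\<lambda>n. t / real (Suc n) * (\<Sum>i=1..Suc n. h (a + real i * (t / real (Suc n)))))
          \<longlonglongrightarrow> integral {a..a + t} h"
proof -
  have "h integrable_on {a..a + t} \<and>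
    (\<lambda>n. t / real (Suc n) * (\<Sum>i=1..Suc n. h (a + real i * (t / real (Suc n)))))
          \<longlonglongrightarrow> integral {a..a + t} h"
  proof (cases "t = 0")
    case True
    then show ?thesis using integrable_on_refl[of h a] by simp
  next
    case False
    with t have t: "t > 0" by simp
    define d where "d n = t / real (Suc n)" for n
    have d: "d n > 0" for n using t by (simp add: d_def)
    define H where "H n u = h (a + d n * of_int \<lceil>(u - a) / d n\<rceil>)" for n u
    have nd: "real (Suc n) * d n = t" for n by (simp add: d_def)
    have HI: "(H n has_integral (d n * (\<Sum>i=1..Suc n. h (a + real i * d n)))) {a..a + t}" for n
      using step_function_has_integral[OF d[of n], of h a "Suc n"] unfolding nd H_def by simp
    have grid: "a + d n * of_int \<lceil>(u - a) / d n\<rceil> \<in> {u..a + t}"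
        "a + d n * of_int \<lceil>(u - a) / d n\<rceil> \<le> u + d n"
      if u: "u \<in> {a..a + t}" for u n
    proof -
      have "u - a \<le> d n * of_int \<lceil>(u - a) / d n\<rceil>"
        using d[of n] le_of_int_ceiling[of "(u - a) / d n"] by (simp only: pos_divide_le_eq mult.commute)
      moreover have "of_int \<lceil>(u - a) / d n\<rceil> \<le> (u - a) / d n + 1" by linarith
      moreover have "\<lceil>(u - a) / d n\<rceil> \<le> int (Suc n)"
      proof -
        have "(u - a) / d n \<le> t / d n" using u d[of n] by (intro divide_right_mono) auto
        also have "t / d n = real (Suc n)" using t by (simp add: d_def)
        finally show ?thesis by (simp add: ceiling_le_iff)
      qed
      then have "d n * of_int \<lceil>(u - a) / d n\<rceil> \<le> d n * real (Suc n)"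
        using d[of n] less_imp_le[OF d[of n]] by (intro mult_left_mono) linarith+
      ultimately show "a + d n * of_int \<lceil>(u - a) / d n\<rceil> \<in> {u..a + t}"
        "a + d n * of_int \<lceil>(u - a) / d n\<rceil> \<le> u + d n"
        using d[of n] nd[of n] by (auto simp: field_simps)
    qed
    have conv: "(\<lambda>n. H n u) \<longlonglongrightarrow> h u" if u: "u \<in> {a..a + t}" for u
    proof -
      \<comment> \<open>The rounded point may equal \<open>u\<close> itself, so the sequential
        criterion is used on the closed half-line, which defines the same filter.\<close>
      have eq: "at u within {u..} = at_right u"
        unfolding at_within_def by (intro arg_cong2[where f=inf] refl arg_cong[where f=principal]) auto
      have c: "continuous (at u within {u..}) h" using rc[OF u] unfolding eq .
      have "d \<longlonglongrightarrow> 0" unfolding d_def by (rule LIMSEQ_Suc) (rule lim_const_over_n)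
      then have 0: "(\<lambda>n. u + d n) \<longlonglongrightarrow> u" by (auto intro!: tendsto_eq_intros)
      have "(\<lambda>n. a + d n * of_int \<lceil>(u - a) / d n\<rceil>) \<longlonglongrightarrow> u"
        by (rule tendsto_sandwich[OF _ _ tendsto_const 0]) (use grid[OF u] in auto)
      then show ?thesis
        using c grid[OF u] unfolding continuous_within_sequentially H_def comp_def by auto
    qed
    have Hi: "H n integrable_on {a..a + t}" for n using HI by (auto simp: integrable_on_def)
    have Hb: "norm (H n u) \<le> C" if "u \<in> {a..a + t}" for n u
      using bd[of "a + d n * of_int \<lceil>(u - a) / d n\<rceil>"] grid(1)[OF that, of n] that
      unfolding H_def real_norm_def by auto
    have "h integrable_on {a..a + t}" "(\<lambda>n. integral {a..a + t} (H n)) \<longlonglongrightarrow> integral {a..a + t} h"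
      by (rule dominated_convergence[OF Hi integrable_const_ivl[of C] Hb conv]; simp)+
    then show ?thesis
      using HI[THEN integral_unique] by (simp add: d_def)
  qed
  then show "h integrable_on {a..a + t}"
    "(\<lambda>n. t / real (Suc n) * (\<Sum>i=1..Suc n. h (a + real i * (t / real (Suc n)))))
          \<longlonglongrightarrow> integral {a..a + t} h" by auto
qed

text \<open>Fekete's subadditive lemma in continuous time. The remainder
  \<open>a (t - n * t1)\<close>, usually handled by local boundedness, is dropped here because
  \<open>a\<close> is non-positive.\<close>

lemma fekete_nonpos_tendsto:
  fixes a :: "real \<Rightarrow> real"
  assumes sub: "\<And>s t. s \<ge> 0 \<Longrightarrow> t \<ge> 0 \<Longrightarrow> a (s + t) \<le> a s + a t"
    and nonpos: "\<And>t. t \<ge> 0 \<Longrightarrow> a t \<le> 0"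
    and lower: "\<And>t. t \<ge> 0 \<Longrightarrow> - F * t \<le> a t"
  shows "((\<lambda>t. a t / t) \<longlongrightarrow> (INF t\<in>{0<..}. a t / t)) at_top"
proof -
  define L where "L = (INF t\<in>{0<..}. a t / t)"
  have bdd: "bdd_below ((\<lambda>t. a t / t) ` {0<..})"
    using lower by (intro bdd_belowI2[of _ "-F"]) (simp add: field_simps)
  have iter: "a (real n * t) \<le> real n * a t" if "t \<ge> 0" for n t
  proof (induction n)
    case 0
    then show ?case using nonpos[of 0] by simp
  next
    case (Suc n)
    have "a (real (Suc n) * t) \<le> a (real n * t) + a t"
      using sub[of "real n * t" t] that by (simp add: algebra_simps)
    with Suc show ?case by (simp add: algebra_simps)
  qed
  have "((\<lambda>t. a t / t) \<longlongrightarrow> L) at_top"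
  proof (rule order_tendstoI)
    fix l assume "l < L"
    show "\<forall>\<^sub>F t in at_top. l < a t / t"
      using eventually_gt_at_top[of 0]
    proof eventually_elim
      case (elim t)
      then have "L \<le> a t / t" unfolding L_def by (intro cINF_lower[OF bdd]) auto
      with \<open>l < L\<close> show ?case by simp
    qed
  next
    fix u assume "L < u"
    then obtain t1 where t1: "t1 > 0" "a t1 / t1 < u"
      unfolding L_def using cINF_less_iff[OF _ bdd, of u] by auto
    have "((\<lambda>t. (1 - t1 / t) * (a t1 / t1)) \<longlongrightarrow> (1 - 0) * (a t1 / t1)) at_top"
      by (intro tendsto_intros real_tendsto_divide_at_top[OF tendsto_const] filterlim_ident)
    then have "\<forall>\<^sub>F t in at_top. (1 - t1 / t) * (a t1 / t1) < u"
      using t1 by (auto dest: order_tendstoD)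
    then show "\<forall>\<^sub>F t in at_top. a t / t < u"
      using eventually_gt_at_top[of 0]
    proof eventually_elim
      case (elim t)
      define n where "n = nat \<lfloor>t / t1\<rfloor>"
      have n: "real n = of_int \<lfloor>t / t1\<rfloor>" using elim t1 by (simp add: n_def)
      have r: "real n * t1 \<le> t" "t - t1 \<le> real n * t1"
      proof -
        have "real n \<le> t / t1" "t / t1 - 1 \<le> real n" unfolding n by linarith+
        then show "real n * t1 \<le> t" "t - t1 \<le> real n * t1" using t1 by (auto simp: field_simps)
      qed
      have "a t \<le> a (real n * t1) + a (t - real n * t1)"
        using sub[of "real n * t1" "t - real n * t1"] r t1 by simp
      also have "\<dots> \<le> real n * a t1" using iter[of t1 n] nonpos[of "t - real n * t1"] r t1 by simp
      also have "\<dots> = real n * t1 * (a t1 / t1)" using t1 by simp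
      \<comment> \<open>The slope \<open>a t1 / t1\<close> is non-positive, so shrinking its factor
        from \<open>n * t1\<close> to \<open>t - t1\<close> increases the product.\<close>
      also have "\<dots> \<le> (t - t1) * (a t1 / t1)"
        using r t1 nonpos[of t1] by (intro mult_right_mono_neg) (auto simp: divide_le_0_iff)
      finally have "a t / t \<le> (t - t1) * (a t1 / t1) / t"
        using elim by (intro divide_right_mono) auto
      also have "\<dots> = (1 - t1 / t) * (a t1 / t1)" using elim by (simp add: field_simps)
      finally show ?case using elim by simp
    qed
  qed
  then show ?thesis unfolding L_def .
qed

text \<open>The Arzela-Ascoli argument on a separable space: a diagonal subsequence converges on a
  countable dense set, and equicontinuity spreads the Cauchy property to every point and continuity
  to the limit.\<close>

lemma equicontinuous_pointwise_subsequence: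
  fixes v :: "nat \<Rightarrow> 'a::{metric_space, second_countable_topology} \<Rightarrow> real"
  assumes bd: "\<And>n x. \<bar>v n x\<bar> \<le> C"
    and eq: "\<And>x \<epsilon>. \<epsilon> > 0 \<Longrightarrow> \<forall>\<^sub>F y in nhds x. \<forall>n. \<bar>v n y - v n x\<bar> \<le> \<epsilon>"
  obtains r g where "strict_mono (r :: nat \<Rightarrow> nat)" "continuous_on UNIV g"
    "\<And>x. (\<lambda>n. v (r n) x) \<longlonglongrightarrow> g x"
proof -
  obtain D :: "'a set" where D: "countable D" "\<And>Y. open Y \<Longrightarrow> Y \<noteq> {} \<Longrightarrow> \<exists>d\<in>D. d \<in> Y"
    using countable_dense_setE by auto
  obtain r where r: "strict_mono (r :: nat \<Rightarrow> nat)"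
    and rD: "\<And>x. x \<in> D \<Longrightarrow> \<exists>l. (\<lambda>n. v (r n) x) \<longlonglongrightarrow> l"
    using function_convergent_subsequence[OF D(1), of v C] bd by (metis real_norm_def)
  have "convergent (\<lambda>n. v (r n) x)" for x
  proof (rule real_Cauchy_convergent, rule metric_CauchyI)
    fix \<epsilon> :: real assume "\<epsilon> > 0"
    then have "\<forall>\<^sub>F y in nhds x. \<forall>n. \<bar>v n y - v n x\<bar> \<le> \<epsilon> / 4" by (intro eq) auto
    then obtain S where S: "open S" "x \<in> S" "\<And>y n. y \<in> S \<Longrightarrow> \<bar>v n y - v n x\<bar> \<le> \<epsilon> / 4"
      unfolding eventually_nhds by blast
    then obtain y where y: "y \<in> D" "y \<in> S" using D(2)[of S] by auto
    from rD[OF y(1)] have "Cauchy (\<lambda>n. v (r n) y)" by (auto intro: LIMSEQ_imp_Cauchy)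
    then obtain N where N: "\<And>m n. m \<ge> N \<Longrightarrow> n \<ge> N \<Longrightarrow> \<bar>v (r m) y - v (r n) y\<bar> < \<epsilon> / 4"
      using \<open>\<epsilon> > 0\<close> unfolding Cauchy_def dist_real_def by (metis zero_less_divide_iff zero_less_numeral)
    show "\<exists>N. \<forall>m\<ge>N. \<forall>n\<ge>N. dist (v (r m) x) (v (r n) x) < \<epsilon>"
    proof (intro exI[of _ N] allI impI)
      fix m n assume "m \<ge> N" "n \<ge> N"
      then show "dist (v (r m) x) (v (r n) x) < \<epsilon>"
        using N[of m n] S(3)[OF y(2), of "r m"] S(3)[OF y(2), of "r n"] \<open>\<epsilon> > 0\<close>
        unfolding dist_real_def by linarith
    qed
  qed
  then have lim: "(\<lambda>n. v (r n) x) \<longlonglongrightarrow> lim (\<lambda>n. v (r n) x)" for x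
    by (simp add: convergent_LIMSEQ_iff)
  have "isCont (\<lambda>x. lim (\<lambda>n. v (r n) x)) x" for x
    unfolding isCont_def tendsto_iff dist_real_def
  proof (intro allI impI)
    fix \<epsilon> :: real assume "\<epsilon> > 0"
    then have "\<forall>\<^sub>F y in nhds x. \<forall>n. \<bar>v n y - v n x\<bar> \<le> \<epsilon> / 2" by (intro eq) auto
    then have "\<forall>\<^sub>F y in at x. \<forall>n. \<bar>v n y - v n x\<bar> \<le> \<epsilon> / 2"
      by (simp add: at_within_def eventually_inf_principal eventually_mono)
    then show "\<forall>\<^sub>F y in at x. \<bar>lim (\<lambda>n. v (r n) y) - lim (\<lambda>n. v (r n) x)\<bar> < \<epsilon>"
    proof eventually_elim
      case (elim y)
      have "\<bar>lim (\<lambda>n. v (r n) y) - lim (\<lambda>n. v (r n) x)\<bar> \<le> \<epsilon> / 2"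
        by (rule LIMSEQ_le_const2[OF tendsto_rabs[OF tendsto_diff[OF lim[of y] lim[of x]]]]) (use elim in auto)
      then show ?case using \<open>\<epsilon> > 0\<close> by simp
    qed
  qed
  then have "continuous_on UNIV (\<lambda>x. lim (\<lambda>n. v (r n) x))"
    by (simp add: continuous_on_eq_continuous_at)
  with r lim that show ?thesis by blast
qed

text \<open>Cover \<open>U\<close> by finitely many neighbourhoods of small oscillation; the
  oscillation bound passes to the limit \<open>g\<close>, so convergence at the finitely many
  centres controls all of \<open>U\<close>. The uniformity is what makes suprema over
  \<open>U\<close> converge.\<close>

lemma equicontinuous_pointwise_imp_uniform:
  fixes v :: "nat \<Rightarrow> 'a::metric_space \<Rightarrow> real"
  assumes eq: "\<And>x \<epsilon>. \<epsilon> > 0 \<Longrightarrow> \<forall>\<^sub>F y in nhds x. \<forall>n. \<bar>v n y - v n x\<bar> \<le> \<epsilon>"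
    and lim: "\<And>x. (\<lambda>n. v n x) \<longlonglongrightarrow> g x" and U: "compact U" and \<epsilon>: "\<epsilon> > 0"
  shows "\<forall>\<^sub>F n in sequentially. \<forall>x\<in>U. \<bar>v n x - g x\<bar> \<le> \<epsilon>"
proof -
  have "\<exists>S. open S \<and> x \<in> S \<and> (\<forall>y\<in>S. \<forall>n. \<bar>v n y - v n x\<bar> \<le> \<epsilon> / 3)" for x
    using eq[of "\<epsilon> / 3" x] \<epsilon> unfolding eventually_nhds by auto
  then obtain S where S: "\<And>x. open (S x)" "\<And>x. x \<in> S x"
      "\<And>x y n. y \<in> S x \<Longrightarrow> \<bar>v n y - v n x\<bar> \<le> \<epsilon> / 3" by metis
  obtain K where K: "K \<subseteq> U" "finite K" "U \<subseteq> (\<Union>x\<in>K. S x)"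
    using compactE_image[OF U, of U S] S by blast
  have "\<forall>\<^sub>F n in sequentially. \<forall>x\<in>K. \<bar>v n x - g x\<bar> < \<epsilon> / 3"
  proof (intro eventually_ball_finite[OF K(2)] ballI)
    fix x
    from \<epsilon> have "\<epsilon> / 3 > 0" by simp
    with lim[of x] show "\<forall>\<^sub>F n in sequentially. \<bar>v n x - g x\<bar> < \<epsilon> / 3"
      unfolding tendsto_iff dist_real_def by blast
  qed
  then show ?thesis
  proof eventually_elim
    case (elim n)
    show ?case
    proof
      fix y assume "y \<in> U"
      then obtain x where x: "x \<in> K" "y \<in> S x" using K by auto
      have "\<bar>g y - g x\<bar> \<le> \<epsilon> / 3"
        by (rule LIMSEQ_le_const2[OF tendsto_rabs[OF tendsto_diff[OF lim[of y] lim[of x]]]])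
          (use S(3)[OF x(2)] in auto)
      moreover have "\<bar>v n x - g x\<bar> < \<epsilon> / 3" using elim x(1) by blast
      ultimately show "\<bar>v n y - g y\<bar> \<le> \<epsilon>" using S(3)[OF x(2), of n] by linarith
    qed
  qed
qed

text \<open>The scaled sum counts the levels \<open>j * e\<close> lying strictly below
  \<open>p\<close>: it is \<open>p\<close> rounded down with error at most \<open>e\<close>, cut off
  at \<open>n * e\<close>. Applied to a function value it replaces the function by a combination of
  indicators of superlevel sets.\<close>

lemma staircase_bounds:
  fixes e p :: real
  assumes "0 \<le> e" "0 \<le> p"
  shows "(real n * e < p \<longrightarrow> e * (\<Sum>j=1..n. indicator {real j * e<..} p) = real n * e) \<and>
    (p \<le> real n * e \<longrightarrow> p - e \<le> e * (\<Sum>j=1..n. indicator {real j * e<..} p) \<and>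
       e * (\<Sum>j=1..n. indicator {real j * e<..} p) \<le> p)"
proof (induction n)
  case 0
  then show ?case using assms by auto
next
  case (Suc n)
  show ?case
  proof (cases "real (Suc n) * e < p")
    case True
    then have "real n * e < p" using assms by (simp add: algebra_simps)
    with True Suc show ?thesis by (simp add: algebra_simps)
  next
    case False
    then have "(\<Sum>j=1..Suc n. indicator {real j * e<..} p) = (\<Sum>j=1..n. indicator {real j * e<..} p :: real)"
      by (simp add: indicator_def)
    with False Suc assms show ?thesis by (cases "real n * e < p") (auto simp: algebra_simps)
  qed
qed

section \<open>Stability of suprema and logarithms\<close>

lemma SUP_diff_le:
  fixes a b :: "'b \<Rightarrow> real"
  assumes "U \<noteq> {}" "bdd_above (a ` U)" "bdd_above (b ` U)" "\<And>\<xi>. \<xi> \<in> U \<Longrightarrow> \<bar>a \<xi> - b \<xi>\<bar> \<le> e"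
  shows "\<bar>(SUP \<xi>\<in>U. a \<xi>) - (SUP \<xi>\<in>U. b \<xi>)\<bar> \<le> e"
proof -
  have "(SUP \<xi>\<in>U. a \<xi>) \<le> (SUP \<xi>\<in>U. b \<xi>) + e"
  proof (rule cSUP_least[OF assms(1)])
    fix \<xi> assume "\<xi> \<in> U"
    then show "a \<xi> \<le> (SUP \<xi>\<in>U. b \<xi>) + e"
      using cSUP_upper[OF _ assms(3), of \<xi>] assms(4)[of \<xi>] by linarith
  qed
  moreover have "(SUP \<xi>\<in>U. b \<xi>) \<le> (SUP \<xi>\<in>U. a \<xi>) + e"
  proof (rule cSUP_least[OF assms(1)])
    fix \<xi> assume "\<xi> \<in> U"
    then show "b \<xi> \<le> (SUP \<xi>\<in>U. a \<xi>) + e"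
      using cSUP_upper[OF _ assms(2), of \<xi>] assms(4)[of \<xi>] by linarith
  qed
  ultimately show ?thesis by linarith
qed

lemma SUP_minus_const:
  fixes a :: "'b \<Rightarrow> real"
  assumes "U \<noteq> {}" "bdd_above (a ` U)"
  shows "(SUP \<xi>\<in>U. a \<xi> - s) = (SUP \<xi>\<in>U. a \<xi>) - s"
proof (rule cSup_eq_non_empty)
  fix y assume "y \<in> (\<lambda>\<xi>. a \<xi> - s) ` U"
  then show "y \<le> (SUP \<xi>\<in>U. a \<xi>) - s" using cSUP_upper[OF _ assms(2)] by auto
next
  fix y assume y: "\<And>z. z \<in> (\<lambda>\<xi>. a \<xi> - s) ` U \<Longrightarrow> z \<le> y"
  have "(SUP \<xi>\<in>U. a \<xi>) \<le> y + s"
  proof (rule cSUP_least[OF assms(1)])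
    fix \<xi> assume "\<xi> \<in> U"
    then show "a \<xi> \<le> y + s" using y[of "a \<xi> - s"] by simp
  qed
  then show "(SUP \<xi>\<in>U. a \<xi>) - s \<le> y" by simp
qed (use assms in simp)

lemma abs_ln_diff_le:
  fixes a u w :: real
  assumes "0 < a" "a \<le> u" "a \<le> w"
  shows "\<bar>ln u - ln w\<bar> \<le> \<bar>u - w\<bar> / a"
proof -
  have *: "ln p - ln q \<le> \<bar>p - q\<bar> / a" if "a \<le> p" "a \<le> q" for p q
  proof -
    have "ln p - ln q = ln (p / q)" using that assms(1) by (simp add: ln_div)
    also have "\<dots> \<le> p / q - 1" using that assms(1) by (intro ln_le_minus_one) auto
    also have "\<dots> = (p - q) / q" using that assms(1) by (simp add: field_simps)
    also have "\<dots> \<le> \<bar>p - q\<bar> / q" using that assms(1) by (intro divide_right_mono) auto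
    also have "\<dots> \<le> \<bar>p - q\<bar> / a" using that assms(1) by (intro divide_left_mono) auto
    finally show ?thesis .
  qed
  from *[of u w] *[of w u] assms show ?thesis by (simp add: abs_minus_commute abs_le_iff)
qed

subsection \<open>The Markov property for the Feynman-Kac operators\<close>

text \<open>Non-negativity allows switching between Bochner and extended non-negative integrals;
  keeping the bound \<open>C\<close> as a parameter allows estimates that are uniform over the whole
  class, as equicontinuity requires.\<close>

definition bdd_borel :: "real \<Rightarrow> ('a::topological_space \<Rightarrow> real) \<Rightarrow> bool" where
  "bdd_borel C \<phi> \<longleftrightarrow> \<phi> \<in> borel_measurable borel \<and> (\<forall>x. 0 \<le> \<phi> x \<and> \<phi> x \<le> C)"

lemma bdd_borelD:
  assumes "bdd_borel C \<phi>"
  shows "\<phi> \<in> borel_measurable borel" "0 \<le> \<phi> x" "\<phi> x \<le> C" "0 \<le> C"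
  using assms by (auto simp: bdd_borel_def intro: order_trans)

locale feynman_kac =
  fixes M :: "'w measure" and Px :: "'a::{metric_space, second_countable_topology} \<Rightarrow> 'w measure"
    and X :: "real \<Rightarrow> 'w \<Rightarrow> 'a" and f :: "'a \<Rightarrow> real" and F :: real
  assumes proc: "standard_Feller_Markov M Px X"
    and A2: "A2 Px X"
    and f_cont: "continuous_on UNIV f" and f_nonpos: "\<And>x. f x \<le> 0" and f_ge: "\<And>x. - F \<le> f x"
begin

section \<open>The process and its natural filtration\<close>

abbreviation N :: "real \<Rightarrow> 'w measure" where
  "N t \<equiv> natfilt M X t"

lemma prob: "prob_space (Px x)"
  and sets_Px [simp, measurable_cong]: "sets (Px x) = sets M"
  and X_measurable: "0 \<le> t \<Longrightarrow> X t \<in> measurable M borel"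
  and X_start: "AE \<omega> in Px x. X 0 \<omega> = x"
  and X_right_cont: "\<omega> \<in> space M \<Longrightarrow> 0 \<le> t \<Longrightarrow> continuous (at_right t) (\<lambda>s. X s \<omega>)"
  using proc unfolding standard_Feller_Markov_def by auto

lemma space_Px [simp]: "space (Px x) = space M"
  using sets_Px by (rule sets_eq_imp_space_eq)

lemma f_measurable [measurable]: "f \<in> borel_measurable borel"
  using f_cont by (rule borel_measurable_continuous_onI)

lemma F_nonneg: "0 \<le> F"
  using f_nonpos[of undefined] f_ge[of undefined] by linarith

lemma space_N [simp]: "space (N t) = space M"
  by (simp add: natfilt_def space_measure_of_conv)

lemma sets_N: "sets (N t) =
    sigma_sets (space M) {X s -` A \<inter> space M | s A. s \<in> {0..t} \<and> A \<in> sets borel}"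
  unfolding natfilt_def by (rule sets_measure_of) auto

lemma X_N: "0 \<le> s \<Longrightarrow> s \<le> t \<Longrightarrow> X s \<in> measurable (N t) borel"
  by (rule measurableI) (auto simp: sets_N intro!: sigma_sets.Basic)

lemma N_subset: "sets (N t) \<subseteq> sets M"
  unfolding sets_N using X_measurable by (intro sets.sigma_sets_subset) (auto intro: measurable_sets)

lemma N_mono: "s \<le> t \<Longrightarrow> sets (N s) \<subseteq> sets (N t)"
  unfolding sets_N by (intro sigma_sets_mono') fastforce

lemma measurable_N_M: "g \<in> measurable (N t) K \<Longrightarrow> g \<in> measurable M K"
  by (rule measurable_from_subalg[of M "N t"]) (auto simp: subalgebra_def N_subset)

lemma measurable_N_mono: "s \<le> t \<Longrightarrow> g \<in> measurable (N s) K \<Longrightarrow> g \<in> measurable (N t) K"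
  by (rule measurable_from_subalg[of "N t" "N s"]) (auto simp: subalgebra_def N_mono)

lemma integrable_bounded:
  assumes "g \<in> borel_measurable M" "\<And>\<omega>. \<omega> \<in> space M \<Longrightarrow> \<bar>g \<omega>\<bar> \<le> (K :: real)"
  shows "integrable (Px x) g"
proof -
  interpret prob_space "Px x" by (rule prob)
  have "g \<in> borel_measurable (Px x)" using assms(1) by measurable
  then show ?thesis using assms(2) by (intro integrable_const_bound[of _ K]) auto
qed

lemma integral_bounds:
  assumes "g \<in> borel_measurable M" "\<And>\<omega>. \<omega> \<in> space M \<Longrightarrow> a \<le> g \<omega>" "\<And>\<omega>. \<omega> \<in> space M \<Longrightarrow> g \<omega> \<le> (b :: real)"
  shows "a \<le> (\<integral>\<omega>. g \<omega> \<partial>Px x)" "(\<integral>\<omega>. g \<omega> \<partial>Px x) \<le> b"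
proof -
  interpret prob_space "Px x" by (rule prob)
  have int: "integrable (Px x) g"
    by (rule integrable_bounded[of _ "\<bar>a\<bar> + \<bar>b\<bar>"]) (use assms in force)+
  show "a \<le> (\<integral>\<omega>. g \<omega> \<partial>Px x)" using int assms(2) by (intro integral_ge_const) auto
  show "(\<integral>\<omega>. g \<omega> \<partial>Px x) \<le> b" using int assms(3) by (intro integral_le_const) auto
qed

lemma integral_abs_le:
  assumes "g \<in> borel_measurable M" "\<And>\<omega>. \<omega> \<in> space M \<Longrightarrow> \<bar>g \<omega>\<bar> \<le> (e :: real)"
  shows "\<bar>\<integral>\<omega>. g \<omega> \<partial>Px x\<bar> \<le> e"
  using integral_bounds[OF assms(1), of "- e" e x] assms(2) by (simp add: abs_le_iff minus_le_iff)

section \<open>Transition probabilities as a measurable kernel\<close>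

lemma Ptrans_bounds: "0 \<le> Ptrans Px X t y A" "Ptrans Px X t y A \<le> 1"
  unfolding Ptrans_def by (auto intro: prob_space.prob_le_1[OF prob])

lemma Ptrans_eq_integral:
  assumes "0 \<le> t" "A \<in> sets borel"
  shows "ennreal (Ptrans Px X t y A) = (\<integral>\<^sup>+\<omega>. indicator A (X t \<omega>) \<partial>Px y)"
proof -
  interpret prob_space "Px y" by (rule prob)
  have [measurable]: "X t \<in> measurable M borel" "A \<in> sets borel"
    using assms X_measurable by auto
  have "(\<integral>\<^sup>+\<omega>. indicator A (X t \<omega>) \<partial>Px y) = (\<integral>\<^sup>+\<omega>. indicator {\<omega> \<in> space (Px y). X t \<omega> \<in> A} \<omega> \<partial>Px y)"
    by (intro nn_integral_cong) (auto simp: indicator_def)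
  also have "\<dots> = emeasure (Px y) {\<omega> \<in> space (Px y). X t \<omega> \<in> A}"
    by (rule nn_integral_indicator) measurable
  finally show ?thesis unfolding Ptrans_def by (simp add: emeasure_eq_measure)
qed

lemma Ptrans_variation:
  assumes "0 < t" "A \<in> sets borel"
  shows "\<bar>Ptrans Px X t y A - Ptrans Px X t x A\<bar> \<le>
    (SUP A\<in>sets borel. \<bar>Ptrans Px X t y A - Ptrans Px X t x A\<bar>)"
proof (rule cSUP_upper[OF assms(2)])
  have "\<bar>Ptrans Px X t y A - Ptrans Px X t x A\<bar> \<le> 1" for A
    using Ptrans_bounds[of t y A] Ptrans_bounds[of t x A] by linarith
  then show "bdd_above ((\<lambda>A. \<bar>Ptrans Px X t y A - Ptrans Px X t x A\<bar>) ` sets borel)"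
    by (intro bdd_aboveI2)
qed

text \<open>For positive \<open>t\<close>, (A2) even makes the transition probability of a fixed
  Borel set continuous in the starting point; at time 0 the kernel is the Dirac mass.\<close>

lemma Ptrans_measurable:
  assumes t: "0 \<le> t" and A: "A \<in> sets borel"
  shows "(\<lambda>y. Ptrans Px X t y A) \<in> borel_measurable borel"
proof (cases "t = 0")
  case True
  have "Ptrans Px X 0 y A = indicator A y" for y
  proof -
    have "ennreal (Ptrans Px X 0 y A) = (\<integral>\<^sup>+\<omega>. indicator A y \<partial>Px y)"
      unfolding Ptrans_eq_integral[OF order_refl A]
      by (intro nn_integral_cong_AE) (use X_start[of y] in auto)
    also have "\<dots> = ennreal (indicator A y)"
      using prob_space.emeasure_space_1[OF prob[of y]] by (simp add: indicator_def)
    finally show ?thesis by (simp add: Ptrans_bounds)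
  qed
  then show ?thesis using A True by simp
next
  case False
  with t have t: "0 < t" by simp
  have "isCont (\<lambda>y. Ptrans Px X t y A) x" for x
    unfolding continuous_at_sequentially comp_def
  proof (intro allI impI)
    fix u assume u: "u \<longlonglongrightarrow> x"
    show "(\<lambda>n. Ptrans Px X t (u n) A) \<longlonglongrightarrow> Ptrans Px X t x A"
    proof (rule Lim_transform_bound[OF _ _, THEN LIM_zero_cancel])
      show "(\<lambda>n. SUP A\<in>sets borel. \<bar>Ptrans Px X t (u n) A - Ptrans Px X t x A\<bar>) \<longlonglongrightarrow> 0"
        using A2 t u unfolding A2_def by blast
      show "\<forall>\<^sub>F n in sequentially. norm (Ptrans Px X t (u n) A - Ptrans Px X t x A) \<le>
          norm (SUP A\<in>sets borel. \<bar>Ptrans Px X t (u n) A - Ptrans Px X t x A\<bar>)"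
        using Ptrans_variation[OF t A] by (intro always_eventually allI) (simp, meson abs_ge_self order_trans)
    qed
  qed
  then show ?thesis
    by (intro borel_measurable_continuous_onI) (simp add: continuous_on_eq_continuous_at)
qed

lemma nn_kernel_measurable:
  assumes t: "0 \<le> t" and \<phi>: "\<phi> \<in> borel_measurable borel"
  shows "(\<lambda>y. \<integral>\<^sup>+\<omega>. \<phi> (X t \<omega>) \<partial>Px y) \<in> borel_measurable borel"
  using \<phi>
proof (induction \<phi> rule: borel_measurable_induct)
  case (cong g h)
  then show ?case by simp
next
  case (set A)
  then show ?case using Ptrans_measurable[OF t] by (simp add: Ptrans_eq_integral[OF t, symmetric])
next
  case (mult u c)
  note X_measurable[OF t, measurable] mult(2)[measurable] mult(4)[measurable]
  show ?case by (simp add: nn_integral_cmult)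
next
  case (add u v)
  note X_measurable[OF t, measurable]
  have [measurable]: "u \<in> borel_measurable borel" "v \<in> borel_measurable borel" using add by auto
  show ?case using add by (simp add: nn_integral_add)
next
  case (seq U)
  note [measurable] = X_measurable[OF t] seq(1) seq(3)
  have "(\<integral>\<^sup>+\<omega>. (SUP i. U i) (X t \<omega>) \<partial>Px y) = (SUP i. \<integral>\<^sup>+\<omega>. U i (X t \<omega>) \<partial>Px y)" for y
    unfolding SUP_apply using \<open>incseq U\<close>
    by (intro nn_integral_monotone_convergence_SUP) (auto simp: incseq_def le_fun_def)
  moreover have "(\<lambda>y. SUP i. \<integral>\<^sup>+\<omega>. U i (X t \<omega>) \<partial>Px y) \<in> borel_measurable borel"
    using seq by (intro borel_measurable_SUP) auto
  ultimately show ?case by presburger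
qed

text \<open>The Markov identity for sets, moved from Bochner to extended non-negative integrals,
  where both factors can be generalised by monotone approximation without integrability side
  conditions.\<close>

lemma markov_indicator:
  assumes s: "0 \<le> s" and t: "0 \<le> t" and A: "A \<in> sets borel" and G: "G \<in> sets (N s)"
  shows "(\<integral>\<^sup>+\<omega>. indicator G \<omega> * indicator A (X (s + t) \<omega>) \<partial>Px x) =
    (\<integral>\<^sup>+\<omega>. indicator G \<omega> * (\<integral>\<^sup>+\<omega>'. indicator A (X t \<omega>') \<partial>Px (X s \<omega>)) \<partial>Px x)"
proof -
  have [measurable]: "X s \<in> measurable M borel" "X (s + t) \<in> measurable M borel" "A \<in> sets borel" "G \<in> sets M"
    using assms X_measurable N_subset by auto
  note [measurable] = Ptrans_measurable[OF t A]
  have m1: "(\<lambda>\<omega>. indicator G \<omega> * indicator A (X (s + t) \<omega>) :: real) \<in> borel_measurable M"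
    and m2: "(\<lambda>\<omega>. indicator G \<omega> * Ptrans Px X t (X s \<omega>) A) \<in> borel_measurable M"
    by measurable
  have i1: "integrable (Px x) (\<lambda>\<omega>. indicator G \<omega> * indicator A (X (s + t) \<omega>) :: real)"
    by (rule integrable_bounded[OF m1, of 1]) (auto simp: indicator_def)
  have i2: "integrable (Px x) (\<lambda>\<omega>. indicator G \<omega> * Ptrans Px X t (X s \<omega>) A)"
    by (rule integrable_bounded[OF m2, of 1]) (auto simp: indicator_def Ptrans_bounds)
  have eq: "(\<integral>\<omega>. indicator G \<omega> * indicator A (X (s + t) \<omega>) \<partial>Px x) =
      (\<integral>\<omega>. indicator G \<omega> * Ptrans Px X t (X s \<omega>) A \<partial>Px x)"
    using proc assms unfolding standard_Feller_Markov_def by blast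
  have "(\<integral>\<^sup>+\<omega>. indicator G \<omega> * indicator A (X (s + t) \<omega>) \<partial>Px x) =
      (\<integral>\<^sup>+\<omega>. ennreal (indicator G \<omega> * indicator A (X (s + t) \<omega>)) \<partial>Px x)"
    by (intro nn_integral_cong) (auto simp: indicator_def)
  also have "\<dots> = (\<integral>\<^sup>+\<omega>. ennreal (indicator G \<omega> * Ptrans Px X t (X s \<omega>) A) \<partial>Px x)"
    using eq by (simp add: nn_integral_eq_integral[OF i1] nn_integral_eq_integral[OF i2] Ptrans_bounds)
  also have "\<dots> = (\<integral>\<^sup>+\<omega>. indicator G \<omega> * (\<integral>\<^sup>+\<omega>'. indicator A (X t \<omega>') \<partial>Px (X s \<omega>)) \<partial>Px x)"
    by (intro nn_integral_cong)
      (auto simp: indicator_def[of G] Ptrans_eq_integral[OF t A, symmetric] simp del: indicator_simps)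
  finally show ?thesis .
qed

lemma markov_nn_integral:
  assumes s: "0 \<le> s" and t: "0 \<le> t" and Y: "Y \<in> borel_measurable (N s)" and \<phi>: "\<phi> \<in> borel_measurable borel"
  shows "(\<integral>\<^sup>+\<omega>. Y \<omega> * \<phi> (X (s + t) \<omega>) \<partial>Px x) =
    (\<integral>\<^sup>+\<omega>. Y \<omega> * (\<integral>\<^sup>+\<omega>'. \<phi> (X t \<omega>') \<partial>Px (X s \<omega>)) \<partial>Px x)"
proof -
  have [measurable]: "X s \<in> measurable M borel" "X (s + t) \<in> measurable M borel" "X t \<in> measurable M borel"
    using s t X_measurable by auto
  note nn_kernel_measurable[OF t, measurable]
  \<comment> \<open>Two successive inductions: here \<open>\<phi>\<close> is general and the past is
    an event \<open>G\<close>; afterwards \<open>\<phi>\<close> stays fixed and the event is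
    generalised to \<open>Y\<close>.\<close>
  have *: "(\<integral>\<^sup>+\<omega>. indicator G \<omega> * \<phi> (X (s + t) \<omega>) \<partial>Px x) =
      (\<integral>\<^sup>+\<omega>. indicator G \<omega> * (\<integral>\<^sup>+\<omega>'. \<phi> (X t \<omega>') \<partial>Px (X s \<omega>)) \<partial>Px x)"
    if G: "G \<in> sets (N s)" for G
    using \<phi>
  proof (induction \<phi> rule: borel_measurable_induct)
    case (cong g h)
    then show ?case by simp
  next
    case (set A)
    then show ?case using markov_indicator[OF s t _ G] by simp
  next
    case (mult u c)
    have [measurable]: "G \<in> sets M" "u \<in> borel_measurable borel" using G N_subset mult by auto
    show ?case using mult by (simp add: nn_integral_cmult mult.left_commute[of _ c])
  next
    case (add u v)
    have [measurable]: "G \<in> sets M" "u \<in> borel_measurable borel" "v \<in> borel_measurable borel"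
      using G N_subset add by auto
    show ?case using add by (simp add: nn_integral_add distrib_left)
  next
    case (seq U)
    have [measurable]: "G \<in> sets M" "\<And>i. U i \<in> borel_measurable borel"
      using G N_subset seq by auto
    have mono: "U i z \<le> U j z" if "i \<le> j" for i j z
      using seq that by (auto simp: incseq_def le_fun_def)
    have "(\<integral>\<^sup>+\<omega>. indicator G \<omega> * (SUP i. U i) (X (s + t) \<omega>) \<partial>Px x) =
        (SUP i. \<integral>\<^sup>+\<omega>. indicator G \<omega> * U i (X (s + t) \<omega>) \<partial>Px x)"
      unfolding SUP_apply SUP_mult_left_ennreal
      by (intro nn_integral_monotone_convergence_SUP) (auto simp: incseq_def le_fun_def intro!: mult_left_mono mono)
    also have "\<dots> = (SUP i. \<integral>\<^sup>+\<omega>. indicator G \<omega> * (\<integral>\<^sup>+\<omega>'. U i (X t \<omega>') \<partial>Px (X s \<omega>)) \<partial>Px x)"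
      using seq by simp
    also have "\<dots> = (\<integral>\<^sup>+\<omega>. indicator G \<omega> * (SUP i. \<integral>\<^sup>+\<omega>'. U i (X t \<omega>') \<partial>Px (X s \<omega>)) \<partial>Px x)"
      unfolding SUP_mult_left_ennreal
      by (intro nn_integral_monotone_convergence_SUP[symmetric])
        (auto simp: incseq_def le_fun_def intro!: mult_left_mono nn_integral_mono mono)
    also have "\<dots> = (\<integral>\<^sup>+\<omega>. indicator G \<omega> * (\<integral>\<^sup>+\<omega>'. (SUP i. U i) (X t \<omega>') \<partial>Px (X s \<omega>)) \<partial>Px x)"
      unfolding SUP_apply
      by (subst nn_integral_monotone_convergence_SUP) (auto simp: incseq_def le_fun_def mono)
    finally show ?case .
  qed
  note [measurable] = \<phi>
  show ?thesis
    using Y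
  proof (induction Y rule: borel_measurable_induct)
    case (cong g h)
    then have "(\<integral>\<^sup>+\<omega>. g \<omega> * Z \<omega> \<partial>Px x) = (\<integral>\<^sup>+\<omega>. h \<omega> * Z \<omega> \<partial>Px x)" for Z
      by (intro nn_integral_cong) auto
    with cong show ?case by simp
  next
    case (set A)
    then show ?case by (rule *)
  next
    case (mult u c)
    note measurable_N_M[OF mult(2), measurable]
    show ?case using mult by (simp add: nn_integral_cmult mult.assoc)
  next
    case (add u v)
    have "u \<in> borel_measurable (N s)" "v \<in> borel_measurable (N s)" using add by auto
    note [measurable] = this[THEN measurable_N_M]
    show ?case using add by (simp add: nn_integral_add distrib_right)
  next
    case (seq U)
    note [measurable] = measurable_N_M[OF seq(1)]
    have mono: "U i z \<le> U j z" if "i \<le> j" for i j z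
      using seq that by (auto simp: incseq_def le_fun_def)
    have "(\<integral>\<^sup>+\<omega>. (SUP i. U i) \<omega> * Z \<omega> \<partial>Px x) = (SUP i. \<integral>\<^sup>+\<omega>. U i \<omega> * Z \<omega> \<partial>Px x)"
      if [measurable]: "Z \<in> borel_measurable M" for Z
      unfolding SUP_apply SUP_mult_right_ennreal
      by (intro nn_integral_monotone_convergence_SUP) (auto simp: incseq_def le_fun_def intro!: mult_right_mono mono)
    with seq show ?case by simp
  qed
qed

definition P :: "real \<Rightarrow> ('a \<Rightarrow> real) \<Rightarrow> 'a \<Rightarrow> real" where
  "P t \<phi> y = (\<integral>\<omega>. \<phi> (X t \<omega>) \<partial>Px y)"

lemma P_eq_enn2real:
  assumes "0 \<le> t" "bdd_borel C \<phi>"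
  shows "P t \<phi> y = enn2real (\<integral>\<^sup>+\<omega>. ennreal (\<phi> (X t \<omega>)) \<partial>Px y)"
proof -
  note [measurable] = X_measurable[OF assms(1)] bdd_borelD(1)[OF assms(2)]
  show ?thesis unfolding P_def
    by (rule integral_eq_nn_integral) (auto simp: bdd_borelD(2)[OF assms(2)])
qed

lemma ennreal_P:
  assumes "0 \<le> t" "bdd_borel C \<phi>"
  shows "ennreal (P t \<phi> y) = (\<integral>\<^sup>+\<omega>. ennreal (\<phi> (X t \<omega>)) \<partial>Px y)"
proof -
  note [measurable] = X_measurable[OF assms(1)] bdd_borelD(1)[OF assms(2)]
  have "integrable (Px y) (\<lambda>\<omega>. \<phi> (X t \<omega>))"
    by (rule integrable_bounded[of _ C]) (use bdd_borelD[OF assms(2)] in auto)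
  then show ?thesis unfolding P_def
    by (rule nn_integral_eq_integral[symmetric]) (auto simp: bdd_borelD(2)[OF assms(2)])
qed

lemma bdd_borel_P:
  assumes "0 \<le> t" "bdd_borel C \<phi>"
  shows "bdd_borel C (P t \<phi>)"
proof -
  note b = bdd_borelD[OF assms(2)]
  note [measurable] = X_measurable[OF assms(1)] b(1)
  have "(\<lambda>y. enn2real (\<integral>\<^sup>+\<omega>. ennreal (\<phi> (X t \<omega>)) \<partial>Px y)) \<in> borel_measurable borel"
    using nn_kernel_measurable[OF assms(1), of "\<lambda>z. ennreal (\<phi> z)"] by measurable
  moreover have "0 \<le> P t \<phi> y" "P t \<phi> y \<le> C" for y
    unfolding P_def by (rule integral_bounds; use b in auto)+
  ultimately show ?thesis unfolding bdd_borel_def P_eq_enn2real[OF assms, abs_def] by auto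
qed

lemma markov_P:
  assumes s: "0 \<le> s" and t: "0 \<le> t" and Y: "Y \<in> borel_measurable (N s)"
    and Y_nonneg: "\<And>\<omega>. \<omega> \<in> space M \<Longrightarrow> 0 \<le> Y \<omega>" and \<phi>: "bdd_borel C \<phi>"
  shows "(\<integral>\<omega>. Y \<omega> * \<phi> (X (s + t) \<omega>) \<partial>Px x) = (\<integral>\<omega>. Y \<omega> * P t \<phi> (X s \<omega>) \<partial>Px x)"
proof -
  note b = bdd_borelD[OF \<phi>] and b' = bdd_borelD[OF bdd_borel_P[OF t \<phi>]]
  have [measurable]: "X s \<in> measurable M borel" "X (s + t) \<in> measurable M borel"
    using s t X_measurable by auto
  note [measurable] = b(1) b'(1) measurable_N_M[OF Y] 
  have "(\<integral>\<omega>. Y \<omega> * \<phi> (X (s + t) \<omega>) \<partial>Px x) = enn2real (\<integral>\<^sup>+\<omega>. ennreal (Y \<omega> * \<phi> (X (s + t) \<omega>)) \<partial>Px x)"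
    by (rule integral_eq_nn_integral) (auto simp: Y_nonneg b)
  also have "(\<integral>\<^sup>+\<omega>. ennreal (Y \<omega> * \<phi> (X (s + t) \<omega>)) \<partial>Px x) =
      (\<integral>\<^sup>+\<omega>. ennreal (Y \<omega>) * ennreal (\<phi> (X (s + t) \<omega>)) \<partial>Px x)"
    by (intro nn_integral_cong) (auto simp: ennreal_mult' Y_nonneg b)
  also have "\<dots> = (\<integral>\<^sup>+\<omega>. ennreal (Y \<omega>) * ennreal (P t \<phi> (X s \<omega>)) \<partial>Px x)"
    unfolding ennreal_P[OF t \<phi>]
    by (rule markov_nn_integral[OF s t, of "\<lambda>\<omega>. ennreal (Y \<omega>)" "\<lambda>z. ennreal (\<phi> z)"])
      (use Y b(1) in measurable)
  also have "\<dots> = (\<integral>\<^sup>+\<omega>. ennreal (Y \<omega> * P t \<phi> (X s \<omega>)) \<partial>Px x)"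
    by (intro nn_integral_cong) (auto simp: ennreal_mult' Y_nonneg b')
  also have "enn2real \<dots> = (\<integral>\<omega>. Y \<omega> * P t \<phi> (X s \<omega>) \<partial>Px x)"
    by (rule integral_eq_nn_integral[symmetric]) (auto simp: Y_nonneg b')
  finally show ?thesis .
qed

lemma AE_start_integral:
  assumes "\<phi> \<in> borel_measurable borel"
  shows "(\<integral>\<omega>. \<phi> (X 0 \<omega>) \<partial>Px y) = (\<phi> y :: real)"
proof -
  note [measurable] = X_measurable[OF order_refl] assms
  have "(\<integral>\<omega>. \<phi> (X 0 \<omega>) \<partial>Px y) = (\<integral>\<omega>. \<phi> y \<partial>Px y)"
    using X_start[of y] by (intro integral_cong_AE) auto
  then show ?thesis using prob_space.prob_space[OF prob[of y]] by simp
qed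

text \<open>The additive functional over \<open>[s, s + t]\<close> is approximated by right Riemann sums with step
  \<open>h\<close>; \<open>Q h n\<close> is the resulting \<open>n\<close>-step approximation of the Feynman-Kac operator.\<close>

definition Q :: "real \<Rightarrow> nat \<Rightarrow> ('a \<Rightarrow> real) \<Rightarrow> 'a \<Rightarrow> real" where
  "Q h n = (\<lambda>\<psi>. P h (\<lambda>z. exp (h * f z) * \<psi> z)) ^^ n"

lemma bdd_borel_weight:
  assumes "0 \<le> h" "bdd_borel C \<psi>"
  shows "bdd_borel C (\<lambda>z. exp (h * f z) * \<psi> z)"
proof -
  note b = bdd_borelD[OF assms(2)]
  note [measurable] = b(1)
  have "exp (h * f z) * \<psi> z \<le> 1 * C" for z
    using assms(1) f_nonpos b by (intro mult_mono) (auto simp: mult_nonneg_nonpos)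
  then show ?thesis using b by (auto simp: bdd_borel_def)
qed

lemma bdd_borel_Q: "0 \<le> h \<Longrightarrow> bdd_borel C \<phi> \<Longrightarrow> bdd_borel C (Q h n \<phi>)"
  by (induction n) (auto simp: Q_def intro: bdd_borel_P bdd_borel_weight)

text \<open>Induction removes the last grid point. Right endpoints matter: the last weight depends
  on the same state as \<open>\<phi>\<close>, so one application of the one-time Markov property
  absorbs both, and the induction hypothesis is used for the function
  \<open>P h ?\<psi>\<close>.\<close>

lemma markov_Q:
  assumes s: "0 \<le> s" and h: "0 \<le> h" and Y: "Y \<in> borel_measurable (N s)"
    and Y_nonneg: "\<And>\<omega>. \<omega> \<in> space M \<Longrightarrow> 0 \<le> Y \<omega>" and \<phi>: "bdd_borel C \<phi>"
  shows "(\<integral>\<omega>. Y \<omega> * (exp (h * (\<Sum>i=1..n. f (X (s + real i * h) \<omega>))) * \<phi> (X (s + real n * h) \<omega>)) \<partial>Px x) =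
    (\<integral>\<omega>. Y \<omega> * Q h n \<phi> (X s \<omega>) \<partial>Px x)"
  using \<phi>
proof (induction n arbitrary: \<phi>)
  case 0
  then show ?case by (simp add: Q_def)
next
  case (Suc n)
  let ?\<psi> = "\<lambda>z. exp (h * f z) * \<phi> z"
  let ?Y = "\<lambda>\<omega>. Y \<omega> * exp (h * (\<Sum>i=1..n. f (X (s + real i * h) \<omega>)))"
  note \<psi> = bdd_borel_weight[OF h Suc.prems]
  have [measurable]: "Y \<in> borel_measurable (N (s + real n * h))"
    using h by (intro measurable_N_mono[OF _ Y]) simp
  have [measurable]: "X (s + real i * h) \<in> measurable (N (s + real n * h)) borel" if "i \<in> {1..n}" for i
    using that s h by (intro X_N) (auto intro: mult_right_mono)
  have "(\<lambda>\<omega>. \<Sum>i=1..n. f (X (s + real i * h) \<omega>)) \<in> borel_measurable (N (s + real n * h))"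
    by (intro borel_measurable_sum) measurable
  then have mY: "?Y \<in> borel_measurable (N (s + real n * h))" by measurable
  have "(\<integral>\<omega>. Y \<omega> * (exp (h * (\<Sum>i=1..Suc n. f (X (s + real i * h) \<omega>))) * \<phi> (X (s + real (Suc n) * h) \<omega>)) \<partial>Px x) =
      (\<integral>\<omega>. ?Y \<omega> * ?\<psi> (X (s + real n * h + h) \<omega>) \<partial>Px x)"
    by (intro Bochner_Integration.integral_cong refl) (simp add: algebra_simps exp_add)
  also have "\<dots> = (\<integral>\<omega>. ?Y \<omega> * P h ?\<psi> (X (s + real n * h) \<omega>) \<partial>Px x)"
    using s h Y_nonneg by (intro markov_P[OF _ h mY _ \<psi>]) auto
  also have "\<dots> = (\<integral>\<omega>. Y \<omega> * Q h n (P h ?\<psi>) (X s \<omega>) \<partial>Px x)"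
    using Suc.IH[OF bdd_borel_P[OF h \<psi>]] by (simp add: mult.assoc)
  \<comment> \<open>Iterates of one operator commute, so the new step may be applied
    innermost.\<close>
  also have "Q h n (P h ?\<psi>) = Q h (Suc n) \<phi>"
    unfolding Q_def funpow_Suc_right by simp
  finally show ?case .
qed

lemma Q_eq:
  assumes h: "0 \<le> h" and \<phi>: "bdd_borel C \<phi>"
  shows "Q h n \<phi> y = (\<integral>\<omega>. exp (h * (\<Sum>i=1..n. f (X (real i * h) \<omega>))) * \<phi> (X (real n * h) \<omega>) \<partial>Px y)"
  using markov_Q[OF order_refl h, of "\<lambda>_. 1" C \<phi> y n] \<phi>
    AE_start_integral[OF bdd_borelD(1)[OF bdd_borel_Q[OF h \<phi>]]] by simp

section \<open>The additive functional of the path\<close>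

definition A :: "real \<Rightarrow> real \<Rightarrow> 'w \<Rightarrow> real" where
  "A s t \<omega> = integral {s..t} (\<lambda>u. f (X u \<omega>))"

lemma path_right_cont:
  assumes "\<omega> \<in> space M" "0 \<le> u"
  shows "continuous (at_right u) (\<lambda>u. f (X u \<omega>))"
  using X_right_cont[OF assms] f_cont
  by (auto intro!: continuous_within_compose3[where f="\<lambda>s. X s \<omega>"] simp: continuous_on_eq_continuous_at)

lemma f_abs: "\<bar>f x\<bar> \<le> F"
  using f_nonpos[of x] f_ge[of x] by linarith

lemma path_integrable:
  assumes "\<omega> \<in> space M" "0 \<le> s"
  shows "(\<lambda>u. f (X u \<omega>)) integrable_on {s..t}"
proof (cases "s \<le> t")
  case True
  then show ?thesis
    using right_continuous_riemann_sums(1)[of "t - s" s "\<lambda>u. f (X u \<omega>)" F] assms path_right_cont f_abs by auto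
qed (simp add: integrable_on_empty)

lemma A_riemann:
  assumes "\<omega> \<in> space M" "0 \<le> s" "0 \<le> t"
  shows "(\<lambda>n. t / real (Suc n) * (\<Sum>i=1..Suc n. f (X (s + real i * (t / real (Suc n))) \<omega>)))
    \<longlonglongrightarrow> A s (s + t) \<omega>"
  unfolding A_def
  by (rule right_continuous_riemann_sums(2)[of t s "\<lambda>u. f (X u \<omega>)" F])
    (use assms path_right_cont f_abs in auto)

text \<open>The integral is taken path by path, so measurability in \<open>\<omega>\<close> is not
  automatic. It is inherited from the Riemann sums, none of whose sampling times exceeds
  \<open>s + t\<close>.\<close>

lemma A_measurable_N:
  assumes "0 \<le> s" "0 \<le> t"
  shows "A s (s + t) \<in> borel_measurable (N (s + t))"
proof (rule borel_measurable_LIMSEQ_real[OF A_riemann[OF _ assms]])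
  show "(\<lambda>\<omega>. t / real (Suc n) * (\<Sum>i=1..Suc n. f (X (s + real i * (t / real (Suc n))) \<omega>)))
      \<in> borel_measurable (N (s + t))" for n
  proof -
    have "X (s + real i * (t / real (Suc n))) \<in> measurable (N (s + t)) borel" if "i \<in> {1..Suc n}" for i
    proof (rule X_N)
      have "real i * (t / real (Suc n)) \<le> real (Suc n) * (t / real (Suc n))"
        using that assms by (intro mult_right_mono) auto
      then show "s + real i * (t / real (Suc n)) \<le> s + t" by simp
    qed (use assms in auto)
    then show ?thesis by (intro borel_measurable_times borel_measurable_const borel_measurable_sum) measurable
  qed
qed simp

lemma A_measurable_N0 [measurable (raw)]: "0 \<le> t \<Longrightarrow> A 0 t \<in> borel_measurable (N t)"
  using A_measurable_N[of 0 t] by simp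

lemma A_measurable:
  assumes "0 \<le> s" "0 \<le> t"
  shows "A s (s + t) \<in> borel_measurable M"
  using A_measurable_N[OF assms] by (rule measurable_N_M)

lemma A_bounds:
  assumes "\<omega> \<in> space M" "0 \<le> s" "s \<le> t"
  shows "A s t \<omega> \<le> 0" "- F * (t - s) \<le> A s t \<omega>"
proof -
  note i = path_integrable[OF assms(1,2), of t]
  show "A s t \<omega> \<le> 0"
    using integral_le[OF i, of "\<lambda>_. 0"] f_nonpos integrable_0[of "{s..t}"] by (simp add: A_def)
  show "- F * (t - s) \<le> A s t \<omega>"
    using integral_le[OF _ i, of "\<lambda>_. - F"] f_ge assms integrable_const_ivl[of "- F" s t]
    by (simp add: A_def mult.commute)
qed

lemma A_combine:
  assumes "\<omega> \<in> space M" "0 \<le> s" "s \<le> t"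
  shows "A 0 t \<omega> = A 0 s \<omega> + A s t \<omega>"
  unfolding A_def using assms by (intro Henstock_Kurzweil_Integration.integral_combine[symmetric] path_integrable) auto

lemma integral_path_minus_const:
  assumes "\<omega> \<in> space M" "0 \<le> t"
  shows "integral {0..t} (\<lambda>s. f (X s \<omega>) - l) = A 0 t \<omega> - l * t"
  using Henstock_Kurzweil_Integration.integral_diff[OF path_integrable[OF assms(1) order_refl, of t]
      integrable_const_ivl[of l 0 t]] assms(2) by (simp add: A_def mult.commute)

section \<open>The Feynman-Kac operator as the limit of its Riemann approximations\<close>

definition T :: "real \<Rightarrow> ('a \<Rightarrow> real) \<Rightarrow> 'a \<Rightarrow> real" where
  "T t \<phi> y = (\<integral>\<omega>. exp (A 0 t \<omega>) * \<phi> (X t \<omega>) \<partial>Px y)"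

text \<open>Since \<open>f\<close> is non-positive, every exponential is at most 1 and
  \<open>K * C\<close> dominates. The factor \<open>Y\<close> lets the same limit serve both for
  \<open>T\<close> itself and for its conditional version.\<close>

lemma riemann_exp_integral_limit:
  assumes s: "0 \<le> s" and t: "0 \<le> t" and Y: "Y \<in> borel_measurable M"
    and Y_bd: "\<And>\<omega>. \<omega> \<in> space M \<Longrightarrow> \<bar>Y \<omega>\<bar> \<le> K" and \<phi>: "bdd_borel C \<phi>"
  shows "(\<lambda>n. \<integral>\<omega>. Y \<omega> * (exp (t / real (Suc n) * (\<Sum>i=1..Suc n. f (X (s + real i * (t / real (Suc n))) \<omega>)))
        * \<phi> (X (s + t) \<omega>)) \<partial>Px x)
    \<longlonglongrightarrow> (\<integral>\<omega>. Y \<omega> * (exp (A s (s + t) \<omega>) * \<phi> (X (s + t) \<omega>)) \<partial>Px x)"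
proof (rule integral_dominated_convergence[where w="\<lambda>_. K * (1 * C)"])
  interpret prob_space "Px x" by (rule prob)
  note b = bdd_borelD[OF \<phi>]
  note [measurable] = b(1) Y A_measurable[OF s t]
  have [measurable]: "X (s + real i * (t / real (Suc n))) \<in> measurable M borel" for i n
    using s t by (intro X_measurable) auto
  have [measurable]: "X (s + t) \<in> measurable M borel" using s t by (intro X_measurable) auto
  show "integrable (Px x) (\<lambda>_. K * (1 * C))" by simp
  show "(\<lambda>\<omega>. Y \<omega> * (exp (A s (s + t) \<omega>) * \<phi> (X (s + t) \<omega>))) \<in> borel_measurable (Px x)"
    by measurable
  show "(\<lambda>\<omega>. Y \<omega> * (exp (t / real (Suc n) * (\<Sum>i=1..Suc n. f (X (s + real i * (t / real (Suc n))) \<omega>)))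
        * \<phi> (X (s + t) \<omega>))) \<in> borel_measurable (Px x)" for n
    by measurable
  show "AE \<omega> in Px x. norm (Y \<omega> * (exp (t / real (Suc n) * (\<Sum>i=1..Suc n. f (X (s + real i * (t / real (Suc n))) \<omega>)))
        * \<phi> (X (s + t) \<omega>))) \<le> K * (1 * C)" for n
  proof (rule AE_I2)
    fix \<omega> assume \<omega>: "\<omega> \<in> space (Px x)"
    have "t / real (Suc n) * (\<Sum>i=1..Suc n. f (X (s + real i * (t / real (Suc n))) \<omega>)) \<le> 0"
      using t f_nonpos by (intro mult_nonneg_nonpos sum_nonpos) auto
    then show "norm (Y \<omega> * (exp (t / real (Suc n) * (\<Sum>i=1..Suc n. f (X (s + real i * (t / real (Suc n))) \<omega>)))
        * \<phi> (X (s + t) \<omega>))) \<le> K * (1 * C)"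
      unfolding real_norm_def abs_mult using Y_bd[of \<omega>] \<omega> b
      by (intro mult_mono) (auto intro: order_trans[OF abs_ge_zero])
  qed
  show "AE \<omega> in Px x. (\<lambda>n. Y \<omega> * (exp (t / real (Suc n) * (\<Sum>i=1..Suc n. f (X (s + real i * (t / real (Suc n))) \<omega>)))
        * \<phi> (X (s + t) \<omega>))) \<longlonglongrightarrow> Y \<omega> * (exp (A s (s + t) \<omega>) * \<phi> (X (s + t) \<omega>))"
    using A_riemann s t by (intro AE_I2 tendsto_intros) auto
qed

lemma Q_tendsto_T:
  assumes t: "0 \<le> t" and \<phi>: "bdd_borel C \<phi>"
  shows "(\<lambda>n. Q (t / real (Suc n)) (Suc n) \<phi> y) \<longlonglongrightarrow> T t \<phi> y"
  using riemann_exp_integral_limit[OF order_refl t, of "\<lambda>_. 1" 1 C \<phi> y] \<phi> t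
  by (simp add: Q_eq[OF _ \<phi>] T_def del: sum.cl_ivl_Suc of_nat_Suc)

text \<open>Measurability in the starting point comes from the approximations \<open>Q\<close>,
  which iterate a measurable kernel.\<close>

lemma bdd_borel_T:
  assumes t: "0 \<le> t" and \<phi>: "bdd_borel C \<phi>"
  shows "bdd_borel C (T t \<phi>)"
proof -
  note b = bdd_borelD[OF bdd_borel_Q[OF _ \<phi>, of "t / real (Suc n)" "Suc n" for n]]
  have "T t \<phi> \<in> borel_measurable borel"
    using t by (intro borel_measurable_LIMSEQ_real[OF Q_tendsto_T[OF t \<phi>] b(1)]) auto
  moreover have "0 \<le> T t \<phi> y" "T t \<phi> y \<le> C" for y
    using t b by (auto intro!: LIMSEQ_le_const[OF Q_tendsto_T[OF t \<phi>]] LIMSEQ_le_const2[OF Q_tendsto_T[OF t \<phi>]])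
  ultimately show ?thesis by (simp add: bdd_borel_def)
qed

text \<open>Conditioning of a functional of the whole path segment after \<open>s\<close>: both
  sides are limits of the two sides of \<open>markov_Q\<close> with step
  \<open>t / Suc n\<close>.\<close>

lemma markov_T:
  assumes s: "0 \<le> s" and t: "0 \<le> t" and Y: "Y \<in> borel_measurable (N s)"
    and Y_nonneg: "\<And>\<omega>. \<omega> \<in> space M \<Longrightarrow> 0 \<le> Y \<omega>" and Y_bd: "\<And>\<omega>. \<omega> \<in> space M \<Longrightarrow> Y \<omega> \<le> K"
    and \<phi>: "bdd_borel C \<phi>"
  shows "(\<integral>\<omega>. Y \<omega> * (exp (A s (s + t) \<omega>) * \<phi> (X (s + t) \<omega>)) \<partial>Px x) = (\<integral>\<omega>. Y \<omega> * T t \<phi> (X s \<omega>) \<partial>Px x)"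
proof (rule LIMSEQ_unique)
  note mY = measurable_N_M[OF Y]
  have YK: "\<bar>Y \<omega>\<bar> \<le> K" if "\<omega> \<in> space M" for \<omega> using Y_nonneg Y_bd that by auto
  show "(\<lambda>n. \<integral>\<omega>. Y \<omega> * (exp (t / real (Suc n) * (\<Sum>i=1..Suc n. f (X (s + real i * (t / real (Suc n))) \<omega>)))
        * \<phi> (X (s + t) \<omega>)) \<partial>Px x)
    \<longlonglongrightarrow> (\<integral>\<omega>. Y \<omega> * (exp (A s (s + t) \<omega>) * \<phi> (X (s + t) \<omega>)) \<partial>Px x)"
    by (rule riemann_exp_integral_limit[OF s t mY YK \<phi>])
  have "(\<lambda>n. \<integral>\<omega>. Y \<omega> * Q (t / real (Suc n)) (Suc n) \<phi> (X s \<omega>) \<partial>Px x)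
      \<longlonglongrightarrow> (\<integral>\<omega>. Y \<omega> * T t \<phi> (X s \<omega>) \<partial>Px x)"
  proof (rule integral_dominated_convergence[where w="\<lambda>_. K * C"])
    interpret prob_space "Px x" by (rule prob)
    note b = bdd_borelD[OF bdd_borel_Q[OF _ \<phi>, of "t / real (Suc n)" "Suc n" for n]]
    note [measurable] = mY X_measurable[OF s] bdd_borelD(1)[OF bdd_borel_T[OF t \<phi>]]
    have [measurable]: "Q (t / real (Suc n)) (Suc n) \<phi> \<in> borel_measurable borel" for n
      using t by (intro b) auto
    show "integrable (Px x) (\<lambda>_. K * C)" by simp
    show "(\<lambda>\<omega>. Y \<omega> * T t \<phi> (X s \<omega>)) \<in> borel_measurable (Px x)" by measurable
    show "(\<lambda>\<omega>. Y \<omega> * Q (t / real (Suc n)) (Suc n) \<phi> (X s \<omega>)) \<in> borel_measurable (Px x)" for n by measurable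
    show "AE \<omega> in Px x. norm (Y \<omega> * Q (t / real (Suc n)) (Suc n) \<phi> (X s \<omega>)) \<le> K * C" for n
    proof (rule AE_I2)
      fix \<omega> assume "\<omega> \<in> space (Px x)"
      then show "norm (Y \<omega> * Q (t / real (Suc n)) (Suc n) \<phi> (X s \<omega>)) \<le> K * C"
        unfolding real_norm_def abs_mult using YK[of \<omega>] b t
        by (intro mult_mono) (auto intro: order_trans[OF abs_ge_zero])
    qed
    show "AE \<omega> in Px x. (\<lambda>n. Y \<omega> * Q (t / real (Suc n)) (Suc n) \<phi> (X s \<omega>)) \<longlonglongrightarrow> Y \<omega> * T t \<phi> (X s \<omega>)"
      by (intro AE_I2 tendsto_intros Q_tendsto_T[OF t \<phi>])
  qed
  moreover have "(\<integral>\<omega>. Y \<omega> * (exp (t / real (Suc n) * (\<Sum>i=1..Suc n. f (X (s + real i * (t / real (Suc n))) \<omega>)))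
        * \<phi> (X (s + t) \<omega>)) \<partial>Px x) = (\<integral>\<omega>. Y \<omega> * Q (t / real (Suc n)) (Suc n) \<phi> (X s \<omega>) \<partial>Px x)" for n
    using markov_Q[OF s _ Y Y_nonneg \<phi>, of "t / real (Suc n)" x "Suc n"] t
    by (simp del: sum.cl_ivl_Suc of_nat_Suc)
  ultimately show "(\<lambda>n. \<integral>\<omega>. Y \<omega> * (exp (t / real (Suc n) * (\<Sum>i=1..Suc n. f (X (s + real i * (t / real (Suc n))) \<omega>)))
        * \<phi> (X (s + t) \<omega>)) \<partial>Px x)
    \<longlonglongrightarrow> (\<integral>\<omega>. Y \<omega> * T t \<phi> (X s \<omega>) \<partial>Px x)" by simp
qed

lemma T_semigroup:
  assumes s: "0 \<le> s" and t: "0 \<le> t" and \<phi>: "bdd_borel C \<phi>"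
  shows "T (s + t) \<phi> x = T s (T t \<phi>) x"
proof -
  have "T (s + t) \<phi> x = (\<integral>\<omega>. exp (A 0 s \<omega>) * (exp (A s (s + t) \<omega>) * \<phi> (X (s + t) \<omega>)) \<partial>Px x)"
    unfolding T_def using s t
    by (intro Bochner_Integration.integral_cong refl) (simp add: A_combine[of _ s "s + t"] exp_add)
  also have "\<dots> = (\<integral>\<omega>. exp (A 0 s \<omega>) * T t \<phi> (X s \<omega>) \<partial>Px x)"
    using s A_bounds(1) A_measurable_N0[OF s] by (intro markov_T[OF s t _ _ _ \<phi>, of _ 1]) auto
  finally show ?thesis unfolding T_def .
qed

subsection \<open>Equicontinuity and growth\<close>

lemma T_integrand_measurable:
  assumes "0 \<le> t" "bdd_borel C \<phi>"
  shows "(\<lambda>\<omega>. exp (A 0 t \<omega>) * \<phi> (X t \<omega>)) \<in> borel_measurable M"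
proof -
  note [measurable] = X_measurable[OF assms(1)] bdd_borelD(1)[OF assms(2)]
    measurable_N_M[OF A_measurable_N0[OF assms(1)]]
  show ?thesis by measurable
qed

lemma T_integrable:
  assumes t: "0 \<le> t" and \<phi>: "bdd_borel C \<phi>"
  shows "integrable (Px x) (\<lambda>\<omega>. exp (A 0 t \<omega>) * \<phi> (X t \<omega>))"
proof (rule integrable_bounded[OF T_integrand_measurable[OF assms], of "1 * C"])
  fix \<omega> assume "\<omega> \<in> space M"
  then show "\<bar>exp (A 0 t \<omega>) * \<phi> (X t \<omega>)\<bar> \<le> 1 * C"
    using A_bounds(1)[of \<omega> 0 t] t bdd_borelD[OF \<phi>] by (intro abs_mult[THEN eq_refl, THEN order_trans] mult_mono) auto
qed

lemma T_mono:
  assumes "0 \<le> t" "bdd_borel C \<phi>" "bdd_borel C' \<psi>" "\<And>z. \<phi> z \<le> \<psi> z"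
  shows "T t \<phi> x \<le> T t \<psi> x"
  unfolding T_def using assms by (intro integral_mono T_integrable) (auto intro!: mult_left_mono)

lemma T_add:
  assumes "0 \<le> t" "bdd_borel C \<phi>" "bdd_borel C' \<psi>"
  shows "T t (\<lambda>z. \<phi> z + \<psi> z) x = T t \<phi> x + T t \<psi> x"
  unfolding T_def distrib_left using assms by (intro Bochner_Integration.integral_add T_integrable)

lemma T_cmult: "T t (\<lambda>z. k * \<phi> z) x = k * T t \<phi> x"
  unfolding T_def by (subst integral_mult_right_zero[symmetric]) (simp add: mult.left_commute)

lemma T_lower:
  assumes t: "0 \<le> t" and \<phi>: "bdd_borel C \<phi>" and a: "0 \<le> a" "\<And>z. a \<le> \<phi> z"
  shows "exp (- F * t) * a \<le> T t \<phi> x"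
  unfolding T_def
proof (rule integral_bounds(1)[OF T_integrand_measurable[OF t \<phi>]])
  fix \<omega> assume "\<omega> \<in> space M"
  then show "exp (- F * t) * a \<le> exp (A 0 t \<omega>) * \<phi> (X t \<omega>)"
    using A_bounds(2)[of \<omega> 0 t] t a by (intro mult_mono) auto
  show "exp (A 0 t \<omega>) * \<phi> (X t \<omega>) \<le> 1 * C"
    using A_bounds(1)[of \<omega> 0 t] t bdd_borelD[OF \<phi>] \<open>\<omega> \<in> space M\<close> by (intro mult_mono) auto
qed

text \<open>Up to a small error \<open>\<psi>\<close> is a sum of \<open>n + 1\<close> indicators of
  weight \<open>C / (n + 1)\<close>. Each indicator changes its expectation by at most the supremum
  over Borel sets, so the weights add up to the factor \<open>C\<close>; then \<open>n\<close> tends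
  to infinity.\<close>

lemma P_variation:
  assumes t: "0 < t" and \<psi>: "bdd_borel C \<psi>"
  shows "\<bar>P t \<psi> y - P t \<psi> x\<bar> \<le> C * (SUP A\<in>sets borel. \<bar>Ptrans Px X t y A - Ptrans Px X t x A\<bar>)"
    (is "_ \<le> C * ?V")
proof -
  note b = bdd_borelD[OF \<psi>]
  note [measurable] = b(1) X_measurable[OF less_imp_le[OF t]]
  have *: "\<bar>P t \<psi> y - P t \<psi> x\<bar> \<le> C * ?V + 2 * (C / real (Suc n))" for n
  proof -
    \<comment> \<open>With this mesh the top level is exactly \<open>C\<close>, so the cut-off in
      \<open>staircase_bounds\<close> never takes effect.\<close>
    define e where "e = C / real (Suc n)"
    have e: "0 \<le> e" "real (Suc n) * e = C" using b(4) by (auto simp: e_def)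
    define L where "L j = {z. real j * e < \<psi> z}" for j
    have L: "L j \<in> sets borel" for j unfolding L_def by measurable
    note [measurable] = L
    have iI: "integrable (Px z) (\<lambda>\<omega>. indicator (L j) (X t \<omega>) :: real)" for z j
      by (rule integrable_bounded[of _ 1]) (auto simp: indicator_def)
    have I: "(\<integral>\<omega>. indicator (L j) (X t \<omega>) \<partial>Px z) = Ptrans Px X t z (L j)" for z j
    proof -
      have "ennreal (\<integral>\<omega>. indicator (L j) (X t \<omega>) \<partial>Px z) = (\<integral>\<^sup>+\<omega>. ennreal (indicator (L j) (X t \<omega>)) \<partial>Px z)"
        by (rule nn_integral_eq_integral[symmetric, OF iI]) simp
      also have "\<dots> = ennreal (Ptrans Px X t z (L j))"
        by (subst Ptrans_eq_integral[OF less_imp_le[OF t] L]) (simp add: ennreal_indicator)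
      finally show ?thesis by (simp add: Ptrans_bounds)
    qed
    have approx: "\<bar>P t \<psi> z - e * (\<Sum>j=1..Suc n. Ptrans Px X t z (L j))\<bar> \<le> e" for z
    proof -
      have st: "\<bar>\<psi> u - e * (\<Sum>j=1..Suc n. indicator (L j) u)\<bar> \<le> e" for u
      proof -
        have "(\<Sum>j=1..Suc n. indicator (L j) u) = (\<Sum>j=1..Suc n. indicator {real j * e<..} (\<psi> u) :: real)"
          by (intro sum.cong) (auto simp: L_def indicator_def)
        then show ?thesis using staircase_bounds[OF e(1) b(2)[of u], of "Suc n"] b(3)[of u] unfolding e(2) by auto
      qed
      have i1: "integrable (Px z) (\<lambda>\<omega>. \<psi> (X t \<omega>))"
        by (rule integrable_bounded[of _ C]) (use b in auto)
      have i2: "integrable (Px z) (\<lambda>\<omega>. e * (\<Sum>j=1..Suc n. indicator (L j) (X t \<omega>)))"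
        by (intro integrable_mult_right Bochner_Integration.integrable_sum iI)
      have "P t \<psi> z - e * (\<Sum>j=1..Suc n. Ptrans Px X t z (L j)) =
          (\<integral>\<omega>. \<psi> (X t \<omega>) - e * (\<Sum>j=1..Suc n. indicator (L j) (X t \<omega>)) \<partial>Px z)"
        unfolding P_def Bochner_Integration.integral_diff[OF i1 i2] I[symmetric]
        by (simp add: Bochner_Integration.integral_sum iI del: sum.cl_ivl_Suc)
      moreover have "\<bar>\<integral>\<omega>. \<psi> (X t \<omega>) - e * (\<Sum>j=1..Suc n. indicator (L j) (X t \<omega>)) \<partial>Px z\<bar> \<le> e"
        by (rule integral_abs_le[OF _ st]) measurable
      ultimately show ?thesis by metis
    qed
    have "\<bar>e * (\<Sum>j=1..Suc n. Ptrans Px X t y (L j)) - e * (\<Sum>j=1..Suc n. Ptrans Px X t x (L j))\<bar> =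
        e * \<bar>\<Sum>j=1..Suc n. Ptrans Px X t y (L j) - Ptrans Px X t x (L j)\<bar>"
      using e(1) by (simp add: right_diff_distrib[symmetric] abs_mult sum_subtractf del: sum.cl_ivl_Suc)
    also have "\<dots> \<le> e * (\<Sum>j=1..Suc n. \<bar>Ptrans Px X t y (L j) - Ptrans Px X t x (L j)\<bar>)"
      by (intro mult_left_mono sum_abs e(1))
    also have "\<dots> \<le> e * (\<Sum>j=1..Suc n. ?V)"
      by (intro mult_left_mono sum_mono e(1) Ptrans_variation[OF t L])
    also have "\<dots> = C * ?V" using e(2) by (simp add: mult.assoc[symmetric] mult.commute)
    finally show ?thesis using approx[of x] approx[of y] unfolding e_def[symmetric] by linarith
  qed
  have "(\<lambda>n. C * ?V + 2 * (C / real (Suc n))) \<longlonglongrightarrow> C * ?V + 2 * 0"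
    by (intro tendsto_intros LIMSEQ_Suc[OF lim_const_over_n])
  then show ?thesis using * by (intro LIMSEQ_le_const) auto
qed

lemma variation_tendsto:
  assumes "0 < t"
  shows "((\<lambda>y. SUP A\<in>sets borel. \<bar>Ptrans Px X t y A - Ptrans Px X t x A\<bar>) \<longlongrightarrow> 0) (nhds x)"
proof -
  define V where "V y = (SUP A\<in>sets borel. \<bar>Ptrans Px X t y A - Ptrans Px X t x A\<bar>)" for y
  have V0: "V x = 0"
  proof -
    have "sets (borel :: 'a measure) \<noteq> {}" by auto
    then show ?thesis unfolding V_def by simp
  qed
  have "isCont V x"
    unfolding continuous_at_sequentially comp_def V0 using A2 assms unfolding A2_def V_def by blast
  then have "(V \<longlongrightarrow> 0) (nhds x)" using tendsto_at_iff_tendsto_nhds[of V x] V0 by (simp add: isCont_def)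
  then show ?thesis unfolding V_def .
qed

text \<open>Ignoring the functional on \<open>[0, h]\<close> replaces a factor between
  \<open>1 - F * h\<close> and 1 by 1. What is left depends on the path after \<open>h\<close> only,
  and conditioning at \<open>h\<close> turns it into \<open>T (t - h) \<phi>\<close> evaluated at
  \<open>X h\<close>.\<close>

lemma T_drop_initial:
  assumes h: "0 \<le> h" "h \<le> t" and \<phi>: "bdd_borel C \<phi>"
  shows "\<bar>T t \<phi> y - P h (T (t - h) \<phi>) y\<bar> \<le> F * h * C"
proof -
  note b = bdd_borelD[OF \<phi>]
  have t: "0 \<le> t" using h by simp
  have [measurable]: "A h t \<in> borel_measurable M" "X t \<in> measurable M borel" "\<phi> \<in> borel_measurable borel"
    "A 0 t \<in> borel_measurable M"
    using A_measurable[of h "t - h"] A_measurable[of 0 t] X_measurable[OF t] b(1) h t by auto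
  have i: "integrable (Px y) (\<lambda>\<omega>. exp (A h t \<omega>) * \<phi> (X t \<omega>))"
  proof (rule integrable_bounded[of _ "1 * C"])
    fix \<omega> assume "\<omega> \<in> space M"
    then show "\<bar>exp (A h t \<omega>) * \<phi> (X t \<omega>)\<bar> \<le> 1 * C"
      using A_bounds(1)[of \<omega> h t] h b by (intro abs_mult[THEN eq_refl, THEN order_trans] mult_mono) auto
  qed measurable
  have "P h (T (t - h) \<phi>) y = (\<integral>\<omega>. exp (A h t \<omega>) * \<phi> (X t \<omega>) \<partial>Px y)"
    unfolding P_def using markov_T[of h "t - h" "\<lambda>_. 1" 1 C \<phi> y] h \<phi> by simp
  then have "P h (T (t - h) \<phi>) y - T t \<phi> y =
      (\<integral>\<omega>. exp (A h t \<omega>) * \<phi> (X t \<omega>) - exp (A 0 t \<omega>) * \<phi> (X t \<omega>) \<partial>Px y)"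
    unfolding T_def using i T_integrable[OF t \<phi>] by (simp add: Bochner_Integration.integral_diff)
  moreover have "0 \<le> exp (A h t \<omega>) * \<phi> (X t \<omega>) - exp (A 0 t \<omega>) * \<phi> (X t \<omega>) \<and>
      exp (A h t \<omega>) * \<phi> (X t \<omega>) - exp (A 0 t \<omega>) * \<phi> (X t \<omega>) \<le> F * h * C" if \<omega>: "\<omega> \<in> space M" for \<omega>
  proof -
    have A0: "A 0 t \<omega> = A 0 h \<omega> + A h t \<omega>" using A_combine[OF \<omega> h] .
    have bh: "- F * h \<le> A 0 h \<omega>" "A 0 h \<omega> \<le> 0" "A h t \<omega> \<le> 0"
      using A_bounds[OF \<omega>, of 0 h] A_bounds[OF \<omega>, of h t] h by auto
    have eq: "exp (A h t \<omega>) * \<phi> (X t \<omega>) - exp (A 0 t \<omega>) * \<phi> (X t \<omega>) =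
        (1 - exp (A 0 h \<omega>)) * (exp (A h t \<omega>) * \<phi> (X t \<omega>))"
      unfolding A0 exp_add by (simp add: algebra_simps)
    have le: "1 - exp (A 0 h \<omega>) \<le> F * h" using exp_ge_add_one_self[of "A 0 h \<omega>"] bh by linarith
    have "exp (A h t \<omega>) * \<phi> (X t \<omega>) \<le> 1 * C" using bh b by (intro mult_mono) auto
    then have "(1 - exp (A 0 h \<omega>)) * (exp (A h t \<omega>) * \<phi> (X t \<omega>)) \<le> F * h * C"
      using le b bh F_nonneg h by (intro mult_mono) auto
    then show ?thesis unfolding eq using bh b by auto
  qed
  then have "\<bar>\<integral>\<omega>. exp (A h t \<omega>) * \<phi> (X t \<omega>) - exp (A 0 t \<omega>) * \<phi> (X t \<omega>) \<partial>Px y\<bar> \<le> F * h * C"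
    by (intro integral_abs_le) auto
  ultimately show ?thesis by linarith
qed

text \<open>Dropping a short initial piece of the additive functional costs little, uniformly in
  \<open>\<phi>\<close>; what remains is \<open>P h\<close> of a bounded function, which is controlled by (A2).\<close>

lemma T_equicontinuous:
  assumes t: "0 < t" and \<epsilon>: "0 < \<epsilon>" and C: "0 \<le> C"
  shows "\<forall>\<^sub>F y in nhds x. \<forall>\<phi>. bdd_borel C \<phi> \<longrightarrow> \<bar>T t \<phi> y - T t \<phi> x\<bar> \<le> \<epsilon>"
proof -
  \<comment> \<open>A third of \<open>\<epsilon>\<close> goes to the truncation error at
    \<open>x\<close>, one to that at \<open>y\<close>, one to the variation of \<open>P h\<close>;
    the \<open>+ 1\<close> avoids a zero denominator.\<close>
  define h where "h = min t (\<epsilon> / (3 * (F * C + 1)))"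
  have FC: "0 \<le> F * C" using F_nonneg C by simp
  have h: "0 < h" "h \<le> t" using t \<epsilon> FC by (auto simp: h_def)
  have hFC: "F * h * C \<le> \<epsilon> / 3"
  proof -
    have "F * h * C = (F * C) * h" by simp
    also have "\<dots> \<le> (F * C + 1) * (\<epsilon> / (3 * (F * C + 1)))"
      using FC h \<epsilon> by (intro mult_mono) (auto simp: h_def)
    also have "\<dots> = \<epsilon> / 3" using FC by (simp add: field_simps)
    finally show ?thesis .
  qed
  have "((\<lambda>y. C * (SUP A\<in>sets borel. \<bar>Ptrans Px X h y A - Ptrans Px X h x A\<bar>)) \<longlongrightarrow> C * 0) (nhds x)"
    by (intro tendsto_intros variation_tendsto h)
  then have "\<forall>\<^sub>F y in nhds x. C * (SUP A\<in>sets borel. \<bar>Ptrans Px X h y A - Ptrans Px X h x A\<bar>) < \<epsilon> / 3"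
    using \<epsilon> by (intro order_tendstoD(2)) auto
  then show ?thesis
  proof eventually_elim
    case (elim y)
    show ?case
    proof (intro allI impI)
      fix \<phi> :: "'a \<Rightarrow> real" assume \<phi>: "bdd_borel C \<phi>"
      have "bdd_borel C (T (t - h) \<phi>)" using h \<phi> by (intro bdd_borel_T) auto
      from P_variation[OF h(1) this, of y x] elim
        T_drop_initial[OF less_imp_le[OF h(1)] h(2) \<phi>, of x] T_drop_initial[OF less_imp_le[OF h(1)] h(2) \<phi>, of y] hFC
      show "\<bar>T t \<phi> y - T t \<phi> x\<bar> \<le> \<epsilon>" by linarith
    qed
  qed
qed

section \<open>The growth rate and exponential bounds\<close>

lemma bdd_borel_one: "bdd_borel 1 (\<lambda>_. 1)"
  by (simp add: bdd_borel_def)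

text \<open>\<open>rate\<close> is defined through \<open>Lim\<close>, which carries information
  only once convergence is known. The semigroup law makes the supremum submultiplicative, and the
  bounds on \<open>f\<close> keep its logarithm between \<open>- F * t\<close> and 0, so Fekete's
  lemma applies.\<close>

lemma rate_limit:
  "((\<lambda>t. ln (SUP x. T t (\<lambda>_. 1) x) / t) \<longlongrightarrow> rate Px X f) at_top"
proof -
  define S where "S t = (SUP x. T t (\<lambda>_. 1) x)" for t
  have b: "T t (\<lambda>_. 1) x \<le> 1" "exp (- F * t) \<le> T t (\<lambda>_. 1) x" if "0 \<le> t" for t x
    using bdd_borelD[OF bdd_borel_T[OF that bdd_borel_one]] T_lower[OF that bdd_borel_one, of 1] by auto
  have up: "T t (\<lambda>_. 1) x \<le> S t" if "0 \<le> t" for t x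
    unfolding S_def using b(1)[OF that] by (intro cSUP_upper bdd_aboveI2[of _ _ 1]) auto
  have S: "S t \<le> 1" "exp (- F * t) \<le> S t" if "0 \<le> t" for t
    using b[OF that] up[OF that] by (auto simp: S_def intro!: cSUP_least intro: order_trans)
  have Spos: "0 < S t" if "0 \<le> t" for t using S(2)[OF that] by (meson exp_gt_zero less_le_trans)
  have sub: "S (s + t) \<le> S s * S t" if st: "0 \<le> s" "0 \<le> t" for s t
    unfolding S_def[of "s + t"]
  proof (rule cSUP_least)
    fix x
    have bS: "bdd_borel (S t * 1) (\<lambda>_. S t * 1)" using Spos[OF st(2)] by (simp add: bdd_borel_def)
    have "T (s + t) (\<lambda>_. 1) x = T s (T t (\<lambda>_. 1)) x"
      by (rule T_semigroup[OF st bdd_borel_one])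
    also have "\<dots> \<le> T s (\<lambda>_. S t * 1) x"
      using up[OF st(2)] by (intro T_mono[OF st(1) bdd_borel_T[OF st(2) bdd_borel_one] bS]) simp
    also have "\<dots> = S t * T s (\<lambda>_. 1) x" by (rule T_cmult)
    also have "\<dots> \<le> S t * S s" using up[OF st(1)] Spos[OF st(2)] by (intro mult_left_mono) auto
    finally show "T (s + t) (\<lambda>_. 1) x \<le> S s * S t" by (simp add: mult.commute)
  qed simp
  have lim: "((\<lambda>t. ln (S t) / t) \<longlongrightarrow> (INF t\<in>{0<..}. ln (S t) / t)) at_top"
  proof (rule fekete_nonpos_tendsto[where F = F])
    fix s t :: real assume st: "0 \<le> s" "0 \<le> t"
    have "ln (S (s + t)) \<le> ln (S s * S t)" using sub[OF st] Spos[of "s + t"] st by simp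
    then show "ln (S (s + t)) \<le> ln (S s) + ln (S t)" using Spos[OF st(1)] Spos[OF st(2)] by (simp add: ln_mult)
  next
    fix t :: real assume t: "0 \<le> t"
    show "ln (S t) \<le> 0" using S(1)[OF t] Spos[OF t] by simp
    show "- F * t \<le> ln (S t)" using S(2)[OF t] Spos[OF t] by (simp add: ln_ge_iff)
  qed
  have "rate Px X f = Lim at_top (\<lambda>t. ln (S t) / t)"
    unfolding rate_def S_def T_def A_def by simp
  also have "\<dots> = (INF t\<in>{0<..}. ln (S t) / t)"
    by (rule tendsto_Lim[OF _ lim]) simp
  finally show ?thesis using lim unfolding S_def by simp
qed

text \<open>The definition of the rate controls large times only. On the remaining bounded interval
  \<open>T\<close> of 1 is at most 1, and the constant \<open>exp (\<bar>l\<bar> * t1)\<close>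
  compensates for \<open>exp (l * t)\<close>, which can be below 1 when \<open>l\<close> is
  negative.\<close>

lemma T_one_growth:
  assumes l: "rate Px X f < l"
  obtains K where "K \<ge> 1" "\<And>t x. 0 \<le> t \<Longrightarrow> T t (\<lambda>_. 1) x \<le> K * exp (l * t)"
proof -
  have "\<forall>\<^sub>F t in at_top. ln (SUP x. T t (\<lambda>_. 1) x) / t < l"
    using rate_limit l by (rule order_tendstoD)
  then obtain t0 where t0: "\<And>t. t \<ge> t0 \<Longrightarrow> ln (SUP x. T t (\<lambda>_. 1) x) / t < l"
    unfolding eventually_at_top_linorder by blast
  define t1 where "t1 = max t0 1"
  have "T t (\<lambda>_. 1) x \<le> exp (\<bar>l\<bar> * t1) * exp (l * t)" if t: "0 \<le> t" for t x
  proof (cases "t \<ge> t1")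
    case True
    have b: "T t (\<lambda>_. 1) x \<le> 1" "exp (- F * t) \<le> T t (\<lambda>_. 1) x" for x
      using bdd_borelD[OF bdd_borel_T[OF t bdd_borel_one]] T_lower[OF t bdd_borel_one, of 1] by auto
    have up: "T t (\<lambda>_. 1) x \<le> (SUP x. T t (\<lambda>_. 1) x)"
      using b(1) by (intro cSUP_upper bdd_aboveI2[of _ _ 1]) auto
    have "0 < T t (\<lambda>_. 1) x" using b(2) by (meson exp_gt_zero less_le_trans)
    with up have pos: "0 < (SUP x. T t (\<lambda>_. 1) x)" by linarith
    have "ln (SUP x. T t (\<lambda>_. 1) x) \<le> l * t"
      using t0[of t] True by (simp add: t1_def field_simps)
    then have "(SUP x. T t (\<lambda>_. 1) x) \<le> exp (l * t)" using pos by (metis exp_le_cancel_iff exp_ln)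
    also have "\<dots> \<le> exp (\<bar>l\<bar> * t1) * exp (l * t)" by (simp add: t1_def)
    finally show ?thesis using up by linarith
  next
    case False
    have "- (l * t) \<le> \<bar>l\<bar> * t1"
      using False t by (smt (verit, best) abs_le_D2 minus_mult_left mult_mono abs_ge_zero)
    then have "1 \<le> exp (\<bar>l\<bar> * t1) * exp (l * t)" by (simp add: exp_add[symmetric])
    with bdd_borelD(3)[OF bdd_borel_T[OF t bdd_borel_one], of x] show ?thesis by linarith
  qed
  moreover have "exp (\<bar>l\<bar> * t1) \<ge> 1" by (simp add: t1_def)
  ultimately show ?thesis using that by blast
qed

lemma T_le_T_one:
  assumes t: "0 \<le> t" and \<phi>: "bdd_borel C \<phi>"
  shows "T t \<phi> x \<le> C * T t (\<lambda>_. 1) x"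
proof -
  have "bdd_borel (C * 1) (\<lambda>_. C * 1)" using bdd_borelD(4)[OF \<phi>] by (simp add: bdd_borel_def)
  from T_mono[OF t \<phi> this, of x] bdd_borelD(3)[OF \<phi>] show ?thesis unfolding T_cmult by simp
qed

lemma T_tendsto:
  assumes t: "0 \<le> t" and \<phi>: "\<And>n. bdd_borel C (\<phi> n)" and \<psi>: "bdd_borel C \<psi>"
    and lim: "\<And>z. (\<lambda>n. \<phi> n z) \<longlonglongrightarrow> \<psi> z"
  shows "(\<lambda>n. T t (\<phi> n) x) \<longlonglongrightarrow> T t \<psi> x"
  unfolding T_def
proof (rule integral_dominated_convergence[where w="\<lambda>_. 1 * C"])
  interpret prob_space "Px x" by (rule prob)
  show "integrable (Px x) (\<lambda>_. 1 * C)" by simp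
  show "(\<lambda>\<omega>. exp (A 0 t \<omega>) * \<psi> (X t \<omega>)) \<in> borel_measurable (Px x)"
    using T_integrable[OF t \<psi>] by (rule borel_measurable_integrable)
  show "(\<lambda>\<omega>. exp (A 0 t \<omega>) * \<phi> n (X t \<omega>)) \<in> borel_measurable (Px x)" for n
    using T_integrable[OF t \<phi>] by (rule borel_measurable_integrable)
  show "AE \<omega> in Px x. norm (exp (A 0 t \<omega>) * \<phi> n (X t \<omega>)) \<le> 1 * C" for n
  proof (rule AE_I2)
    fix \<omega> assume "\<omega> \<in> space (Px x)"
    then show "norm (exp (A 0 t \<omega>) * \<phi> n (X t \<omega>)) \<le> 1 * C"
      unfolding real_norm_def abs_mult
      using A_bounds(1)[of \<omega> 0 t] t bdd_borelD[OF \<phi>] by (intro mult_mono) auto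
  qed
  show "AE \<omega> in Px x. (\<lambda>n. exp (A 0 t \<omega>) * \<phi> n (X t \<omega>)) \<longlonglongrightarrow> exp (A 0 t \<omega>) * \<psi> (X t \<omega>)"
    by (intro AE_I2 tendsto_intros lim)
qed

subsection \<open>Dyadic optimal stopping\<close>

text \<open>The discounted reward for stopping at the \<open>k\<close>-th grid point. It is a
  supermartingale in \<open>k\<close> when \<open>\<psi>\<close> dominates
  \<open>exp (- l * d) * T d \<psi>\<close>.\<close>

definition Z :: "real \<Rightarrow> real \<Rightarrow> ('a \<Rightarrow> real) \<Rightarrow> nat \<Rightarrow> 'w \<Rightarrow> real" where
  "Z l d \<psi> k \<omega> = exp (A 0 (real k * d) \<omega> - l * (real k * d)) * \<psi> (X (real k * d) \<omega>)"

text \<open>For the almost surely bounded rules considered below, the default value 0 at infinity is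
  taken on a null set.\<close>

definition J :: "real \<Rightarrow> real \<Rightarrow> ('a \<Rightarrow> real) \<Rightarrow> ('w \<Rightarrow> enat) \<Rightarrow> 'a \<Rightarrow> real" where
  "J l d G \<sigma> x = (\<integral>\<omega>. (case \<sigma> \<omega> of enat k \<Rightarrow> Z l d G k \<omega> | \<infinity> \<Rightarrow> 0) \<partial>Px x)"

lemma Z_measurable:
  assumes "0 < d" "bdd_borel C \<psi>"
  shows "Z l d \<psi> k \<in> borel_measurable M"
proof -
  have k: "0 \<le> real k * d" using assms by simp
  note [measurable] = X_measurable[OF k] bdd_borelD(1)[OF assms(2)] measurable_N_M[OF A_measurable_N0[OF k]]
  show ?thesis unfolding Z_def[abs_def] by measurable
qed

lemma Z_bounds:
  assumes "0 < d" "bdd_borel C \<psi>" "\<omega> \<in> space M"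
  shows "0 \<le> Z l d \<psi> k \<omega>" "Z l d \<psi> k \<omega> \<le> exp (- l * (real k * d)) * C"
proof -
  note b = bdd_borelD[OF assms(2)]
  show "0 \<le> Z l d \<psi> k \<omega>" using b by (simp add: Z_def)
  show "Z l d \<psi> k \<omega> \<le> exp (- l * (real k * d)) * C"
    unfolding Z_def using b A_bounds(1)[OF assms(3), of 0 "real k * d"] assms(1)
    by (intro mult_mono) auto
qed

lemma Z_integrable:
  assumes "0 < d" "bdd_borel C \<psi>" "E \<in> sets M"
  shows "integrable (Px x) (\<lambda>\<omega>. indicator E \<omega> * Z l d \<psi> k \<omega>)"
proof (rule integrable_bounded[of _ "exp (- l * (real k * d)) * C"])
  note [measurable] = Z_measurable[OF assms(1,2)] assms(3)
  show "(\<lambda>\<omega>. indicator E \<omega> * Z l d \<psi> k \<omega>) \<in> borel_measurable M" by measurable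
  fix \<omega> assume "\<omega> \<in> space M"
  then show "\<bar>indicator E \<omega> * Z l d \<psi> k \<omega>\<bar> \<le> exp (- l * (real k * d)) * C"
    using Z_bounds[OF assms(1,2), of \<omega> l k] bdd_borelD(4)[OF assms(2)] by (auto simp: indicator_def)
qed

lemma Z_mono:
  assumes "0 < d" "bdd_borel C \<psi>" "bdd_borel C' \<psi>'" "E \<in> sets M"
    and "\<And>z. \<psi> z \<le> \<psi>' z"
  shows "(\<integral>\<omega>. indicator E \<omega> * Z l d \<psi> k \<omega> \<partial>Px x) \<le> (\<integral>\<omega>. indicator E \<omega> * Z l d \<psi>' k \<omega> \<partial>Px x)"
  using assms by (intro integral_mono Z_integrable) (auto simp: indicator_def Z_def)

lemma Z_split:
  assumes "0 < d" "bdd_borel C \<psi>" "E1 \<in> sets M" "E2 \<in> sets M" "E1 \<inter> E2 = {}" "E = E1 \<union> E2"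
  shows "(\<integral>\<omega>. indicator E \<omega> * Z l d \<psi> k \<omega> \<partial>Px x) =
    (\<integral>\<omega>. indicator E1 \<omega> * Z l d \<psi> k \<omega> \<partial>Px x) + (\<integral>\<omega>. indicator E2 \<omega> * Z l d \<psi> k \<omega> \<partial>Px x)"
proof -
  have "(\<integral>\<omega>. indicator E \<omega> * Z l d \<psi> k \<omega> \<partial>Px x) =
      (\<integral>\<omega>. indicator E1 \<omega> * Z l d \<psi> k \<omega> + indicator E2 \<omega> * Z l d \<psi> k \<omega> \<partial>Px x)"
    using assms(5,6) by (intro Bochner_Integration.integral_cong) (auto simp: indicator_def)
  also have "\<dots> = (\<integral>\<omega>. indicator E1 \<omega> * Z l d \<psi> k \<omega> \<partial>Px x) + (\<integral>\<omega>. indicator E2 \<omega> * Z l d \<psi> k \<omega> \<partial>Px x)"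
    using assms by (intro Bochner_Integration.integral_add Z_integrable)
  finally show ?thesis .
qed

text \<open>Conditioning at time \<open>k * d\<close>, where the event \<open>E\<close> is already
  decided; the discount of the additional step moves into the function.\<close>

lemma Z_step:
  assumes d: "0 < d" and \<psi>: "bdd_borel C \<psi>" and E: "E \<in> sets (N (real k * d))"
  shows "(\<integral>\<omega>. indicator E \<omega> * Z l d \<psi> (Suc k) \<omega> \<partial>Px x) =
    (\<integral>\<omega>. indicator E \<omega> * Z l d (\<lambda>z. exp (- l * d) * T d \<psi> z) k \<omega> \<partial>Px x)"
proof -
  let ?s = "real k * d"
  have s: "0 \<le> ?s" "0 \<le> d" using d by auto
  note [measurable] = E A_measurable_N0[OF s(1)]
  let ?Y = "\<lambda>\<omega>. indicator E \<omega> * exp (A 0 ?s \<omega> - l * (?s + d))"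
  have "(\<integral>\<omega>. indicator E \<omega> * Z l d \<psi> (Suc k) \<omega> \<partial>Px x) =
      (\<integral>\<omega>. ?Y \<omega> * (exp (A ?s (?s + d) \<omega>) * \<psi> (X (?s + d) \<omega>)) \<partial>Px x)"
  proof (intro Bochner_Integration.integral_cong refl)
    fix \<omega> assume "\<omega> \<in> space (Px x)"
    then have "A 0 (?s + d) \<omega> = A 0 ?s \<omega> + A ?s (?s + d) \<omega>" using s by (intro A_combine) auto
    moreover have "real (Suc k) * d = ?s + d" by (simp add: algebra_simps)
    ultimately show "indicator E \<omega> * Z l d \<psi> (Suc k) \<omega> = ?Y \<omega> * (exp (A ?s (?s + d) \<omega>) * \<psi> (X (?s + d) \<omega>))"
      unfolding Z_def by (simp add: exp_add exp_diff field_simps)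
  qed
  also have "\<dots> = (\<integral>\<omega>. ?Y \<omega> * T d \<psi> (X ?s \<omega>) \<partial>Px x)"
  proof (rule markov_T[OF s _ _ _ \<psi>])
    fix \<omega> assume "\<omega> \<in> space M"
    then show "?Y \<omega> \<le> exp (- l * (?s + d))"
      using A_bounds(1)[of \<omega> 0 ?s] s by (auto simp: indicator_def)
  qed auto
  also have "\<dots> = (\<integral>\<omega>. indicator E \<omega> * Z l d (\<lambda>z. exp (- l * d) * T d \<psi> z) k \<omega> \<partial>Px x)"
    by (intro Bochner_Integration.integral_cong refl)
      (simp add: Z_def exp_add exp_diff exp_minus field_simps)
  finally show ?thesis .
qed

lemma Z_0:
  assumes "bdd_borel C \<psi>"
  shows "(\<integral>\<omega>. indicator (space M) \<omega> * Z l d \<psi> 0 \<omega> \<partial>Px x) = \<psi> x"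
proof -
  have "(\<integral>\<omega>. indicator (space M) \<omega> * Z l d \<psi> 0 \<omega> \<partial>Px x) = (\<integral>\<omega>. \<psi> (X 0 \<omega>) \<partial>Px x)"
    by (intro Bochner_Integration.integral_cong) (auto simp: Z_def A_def)
  then show ?thesis using AE_start_integral[OF bdd_borelD(1)[OF assms]] by simp
qed

lemma J_eq_sum:
  assumes d: "0 < d" and G: "bdd_borel C G"
    and \<sigma>: "\<And>k. {\<omega> \<in> space M. \<sigma> \<omega> = enat k} \<in> sets (N (real k * d))"
    and fin: "AE \<omega> in Px x. \<sigma> \<omega> \<le> enat n"
  shows "J l d G \<sigma> x = (\<Sum>k\<le>n. \<integral>\<omega>. indicator {\<omega> \<in> space M. \<sigma> \<omega> = enat k} \<omega> * Z l d G k \<omega> \<partial>Px x)"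
    and "(\<lambda>\<omega>. case \<sigma> \<omega> of enat k \<Rightarrow> Z l d G k \<omega> | \<infinity> \<Rightarrow> 0) \<in> borel_measurable M"
    and "AE \<omega> in Px x. (case \<sigma> \<omega> of enat k \<Rightarrow> Z l d G k \<omega> | \<infinity> \<Rightarrow> 0) =
      (\<Sum>k\<le>n. indicator {\<omega> \<in> space M. \<sigma> \<omega> = enat k} \<omega> * Z l d G k \<omega>)"
proof -
  have \<sigma>M: "{\<omega> \<in> space M. \<sigma> \<omega> = enat k} \<in> sets M" for k using \<sigma> N_subset by blast
  note [measurable] = Z_measurable[OF d G] \<sigma>M
  \<comment> \<open>Only the events of finite stopping are given as measurable; stopping at infinity
    is the complement of their countable union.\<close>
  have "\<sigma> \<in> measurable M (count_space UNIV)"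
  proof (subst measurable_count_space_eq_countable, simp, intro conjI ballI)
    fix e :: enat
    show "\<sigma> -` {e} \<inter> space M \<in> sets M"
    proof (cases e)
      case (enat k)
      have "\<sigma> -` {e} \<inter> space M = {\<omega> \<in> space M. \<sigma> \<omega> = enat k}" using enat by auto
      then show ?thesis by simp
    next
      case infinity
      have "\<sigma> -` {e} \<inter> space M = space M - (\<Union>k. {\<omega> \<in> space M. \<sigma> \<omega> = enat k})"
        using infinity not_infinity_eq by auto
      then show ?thesis by simp
    qed
  qed simp
  then show m: "(\<lambda>\<omega>. case \<sigma> \<omega> of enat k \<Rightarrow> Z l d G k \<omega> | \<infinity> \<Rightarrow> 0) \<in> borel_measurable M"
    by (rule measurable_compose_countable[rotated, where f="\<lambda>e \<omega>. case e of enat k \<Rightarrow> Z l d G k \<omega> | \<infinity> \<Rightarrow> 0"])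
      (simp split: enat.split)
  show ae: "AE \<omega> in Px x. (case \<sigma> \<omega> of enat k \<Rightarrow> Z l d G k \<omega> | \<infinity> \<Rightarrow> 0) =
      (\<Sum>k\<le>n. indicator {\<omega> \<in> space M. \<sigma> \<omega> = enat k} \<omega> * Z l d G k \<omega>)"
    using fin AE_space
  proof eventually_elim
    case (elim \<omega>)
    then obtain j where j: "\<sigma> \<omega> = enat j" "j \<le> n" by (cases "\<sigma> \<omega>") auto
    have "(\<Sum>k\<le>n. indicator {\<omega> \<in> space M. \<sigma> \<omega> = enat k} \<omega> * Z l d G k \<omega>) =
        (\<Sum>k\<le>n. if k = j then Z l d G j \<omega> else 0)"
      using elim j by (intro sum.cong) (auto simp: indicator_def)
    also have "\<dots> = Z l d G j \<omega>" using j by simp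
    finally show ?case using j by simp
  qed
  have "J l d G \<sigma> x = (\<integral>\<omega>. (\<Sum>k\<le>n. indicator {\<omega> \<in> space M. \<sigma> \<omega> = enat k} \<omega> * Z l d G k \<omega>) \<partial>Px x)"
    unfolding J_def
  proof (rule integral_cong_AE[OF _ _ ae])
    have "(\<lambda>\<omega>. \<Sum>k\<le>n. indicator {\<omega> \<in> space M. \<sigma> \<omega> = enat k} \<omega> * Z l d G k \<omega>) \<in> borel_measurable M"
      by measurable
    then show "(\<lambda>\<omega>. \<Sum>k\<le>n. indicator {\<omega> \<in> space M. \<sigma> \<omega> = enat k} \<omega> * Z l d G k \<omega>) \<in> borel_measurable (Px x)"
      by (simp only: measurable_cong_sets[OF sets_Px refl])
  qed (use m in simp)
  also have "\<dots> = (\<Sum>k\<le>n. \<integral>\<omega>. indicator {\<omega> \<in> space M. \<sigma> \<omega> = enat k} \<omega> * Z l d G k \<omega> \<partial>Px x)"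
    by (intro Bochner_Integration.integral_sum Z_integrable[OF d G \<sigma>M])
  finally show "J l d G \<sigma> x = (\<Sum>k\<le>n. \<integral>\<omega>. indicator {\<omega> \<in> space M. \<sigma> \<omega> = enat k} \<omega> * Z l d G k \<omega> \<partial>Px x)" .
qed

text \<open>Optional stopping for the supermartingale built from \<open>\<theta>\<close>, in
  telescoped form: the expected value of the part still running plus that of the parts already
  stopped never exceeds \<open>\<theta> x\<close>.\<close>

lemma J_le:
  assumes d: "0 < d" and G: "bdd_borel C G" and \<theta>: "bdd_borel C \<theta>"
    and le: "\<And>z. G z \<le> \<theta> z" "\<And>z. exp (- l * d) * T d \<theta> z \<le> \<theta> z"
    and \<sigma>: "\<sigma> \<in> dyadic_stopping_times M Px X d x"
  shows "J l d G \<sigma> x \<le> \<theta> x"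
proof -
  obtain n where fin: "AE \<omega> in Px x. \<sigma> \<omega> \<le> enat n"
    and \<sigma>N: "\<And>k. {\<omega> \<in> space M. \<sigma> \<omega> = enat k} \<in> sets (N (real k * d))"
    using \<sigma> unfolding dyadic_stopping_times_def by auto
  have \<sigma>M: "{\<omega> \<in> space M. \<sigma> \<omega> = enat k} \<in> sets M" for k using \<sigma>N N_subset by blast
  define E where "E k = {\<omega> \<in> space M. enat k \<le> \<sigma> \<omega>}" for k
  have E0: "E 0 = space M" by (auto simp: E_def zero_enat_def[symmetric])
  \<comment> \<open>Having to continue to step \<open>k + 1\<close> is decided at step
    \<open>k\<close>; this shift of index is what allows \<open>Z_step\<close> on
    \<open>E (Suc k)\<close>.\<close>
  have EN: "E (Suc k) \<in> sets (N (real k * d))" for k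
  proof -
    have "E (Suc k) = space (N (real k * d)) - (\<Union>j\<le>k. {\<omega> \<in> space M. \<sigma> \<omega> = enat j})"
    proof -
      have "enat (Suc k) \<le> e \<longleftrightarrow> (\<forall>j\<le>k. e \<noteq> enat j)" for e
        by (cases e) (auto simp: Suc_le_eq not_le[symmetric])
      then show ?thesis by (auto simp: E_def)
    qed
    moreover have "{\<omega> \<in> space M. \<sigma> \<omega> = enat j} \<in> sets (N (real k * d))" if "j \<le> k" for j
      using \<sigma>N[of j] N_mono[of "real j * d" "real k * d"] that d by (auto intro: mult_right_mono)
    then have "(\<Union>j\<le>k. {\<omega> \<in> space M. \<sigma> \<omega> = enat j}) \<in> sets (N (real k * d))"
      by (intro sets.finite_UN) auto
    ultimately show ?thesis by (metis sets.compl_sets)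
  qed
  have EM: "E k \<in> sets M" for k
    using EN N_subset E0 by (cases k) (auto simp del: E_def)
  have Esplit: "E k = {\<omega> \<in> space M. \<sigma> \<omega> = enat k} \<union> E (Suc k)" "{\<omega> \<in> space M. \<sigma> \<omega> = enat k} \<inter> E (Suc k) = {}" for k
  proof -
    have "enat k \<le> e \<longleftrightarrow> e = enat k \<or> enat (Suc k) \<le> e" "e = enat k \<Longrightarrow> \<not> enat (Suc k) \<le> e" for e
      by (cases e; auto)+
    then show "E k = {\<omega> \<in> space M. \<sigma> \<omega> = enat k} \<union> E (Suc k)" "{\<omega> \<in> space M. \<sigma> \<omega> = enat k} \<inter> E (Suc k) = {}"
      unfolding E_def by auto
  qed
  have T\<theta>: "bdd_borel (exp (- l * d) * C) (\<lambda>z. exp (- l * d) * T d \<theta> z)"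
    using bdd_borelD[OF bdd_borel_T[OF less_imp_le[OF d] \<theta>]] by (auto simp: bdd_borel_def)
  have super: "(\<integral>\<omega>. indicator (E k) \<omega> * Z l d \<theta> k \<omega> \<partial>Px x) +
      (\<Sum>j<k. \<integral>\<omega>. indicator {\<omega> \<in> space M. \<sigma> \<omega> = enat j} \<omega> * Z l d \<theta> j \<omega> \<partial>Px x) \<le> \<theta> x" for k
  proof (induction k)
    case 0
    then show ?case using Z_0[OF \<theta>] by (simp add: E0)
  next
    case (Suc k)
    have "(\<integral>\<omega>. indicator (E (Suc k)) \<omega> * Z l d \<theta> (Suc k) \<omega> \<partial>Px x) =
        (\<integral>\<omega>. indicator (E (Suc k)) \<omega> * Z l d (\<lambda>z. exp (- l * d) * T d \<theta> z) k \<omega> \<partial>Px x)"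
      by (rule Z_step[OF d \<theta> EN])
    also have "\<dots> \<le> (\<integral>\<omega>. indicator (E (Suc k)) \<omega> * Z l d \<theta> k \<omega> \<partial>Px x)"
      by (rule Z_mono[OF d T\<theta> \<theta> EM le(2)])
    finally show ?case
      using Suc Z_split[OF d \<theta> \<sigma>M EM Esplit(2)[of k] Esplit(1)[of k], where l = l and k = k and x = x]
      unfolding sum.lessThan_Suc by linarith
  qed
  have "J l d G \<sigma> x = (\<Sum>k\<le>n. \<integral>\<omega>. indicator {\<omega> \<in> space M. \<sigma> \<omega> = enat k} \<omega> * Z l d G k \<omega> \<partial>Px x)"
    by (rule J_eq_sum(1)[OF d G \<sigma>N fin])
  also have "\<dots> \<le> (\<Sum>k\<le>n. \<integral>\<omega>. indicator {\<omega> \<in> space M. \<sigma> \<omega> = enat k} \<omega> * Z l d \<theta> k \<omega> \<partial>Px x)"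
    by (intro sum_mono Z_mono[OF d G \<theta> \<sigma>M le(1)])
  also have "\<dots> = (\<Sum>k<Suc n. \<integral>\<omega>. indicator {\<omega> \<in> space M. \<sigma> \<omega> = enat k} \<omega> * Z l d \<theta> k \<omega> \<partial>Px x)"
    by (simp add: lessThan_Suc_atMost)
  also have "\<dots> \<le> \<theta> x"
  proof -
    have "0 \<le> (\<integral>\<omega>. indicator (E (Suc n)) \<omega> * Z l d \<theta> (Suc n) \<omega> \<partial>Px x)"
      using Z_bounds[OF d \<theta>] by (intro integral_nonneg_AE AE_I2) auto
    then show ?thesis using super[of "Suc n"] by linarith
  qed
  finally show ?thesis .
qed

text \<open>Strict positivity is needed to take logarithms in the final supremum. The rule stops
  almost surely by step \<open>n\<close>, which bounds the weight from below;
  \<open>\<bar>l\<bar>\<close> appears because the sign of \<open>l\<close> is not known.\<close>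

lemma J_pos:
  assumes d: "0 < d" and G: "bdd_borel C G" and a: "0 < a" "\<And>z. a \<le> G z"
    and \<sigma>: "\<sigma> \<in> dyadic_stopping_times M Px X d x"
  shows "0 < J l d G \<sigma> x"
proof -
  obtain n where fin: "AE \<omega> in Px x. \<sigma> \<omega> \<le> enat n"
    and \<sigma>N: "\<And>k. {\<omega> \<in> space M. \<sigma> \<omega> = enat k} \<in> sets (N (real k * d))"
    using \<sigma> unfolding dyadic_stopping_times_def by auto
  have \<sigma>M: "{\<omega> \<in> space M. \<sigma> \<omega> = enat k} \<in> sets M" for k using \<sigma>N N_subset by blast
  interpret prob_space "Px x" by (rule prob)
  let ?c = "exp (- (F + \<bar>l\<bar>) * (real n * d)) * a"
  have "?c \<le> J l d G \<sigma> x"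
    unfolding J_def
  proof (rule integral_ge_const)
    have "integrable (Px x) (\<lambda>\<omega>. \<Sum>k\<le>n. indicator {\<omega> \<in> space M. \<sigma> \<omega> = enat k} \<omega> * Z l d G k \<omega>)"
      by (intro Bochner_Integration.integrable_sum Z_integrable[OF d G \<sigma>M])
    then show "integrable (Px x) (\<lambda>\<omega>. case \<sigma> \<omega> of enat k \<Rightarrow> Z l d G k \<omega> | \<infinity> \<Rightarrow> 0)"
      using J_eq_sum(2,3)[OF d G \<sigma>N fin, of l]
      by (subst integrable_cong_AE[OF _ _ J_eq_sum(3)[OF d G \<sigma>N fin]]) (auto dest: borel_measurable_integrable)
    show "AE \<omega> in Px x. ?c \<le> (case \<sigma> \<omega> of enat k \<Rightarrow> Z l d G k \<omega> | \<infinity> \<Rightarrow> 0)"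
      using fin AE_space
    proof eventually_elim
      case (elim \<omega>)
      then obtain k where k: "\<sigma> \<omega> = enat k" "k \<le> n" by (cases "\<sigma> \<omega>") auto
      have kd: "0 \<le> real k * d" "real k * d \<le> real n * d" using k d by (auto intro: mult_right_mono)
      have "- (F + \<bar>l\<bar>) * (real n * d) \<le> - (F + \<bar>l\<bar>) * (real k * d)"
        using kd F_nonneg by (intro mult_left_mono_neg) auto
      also have "\<dots> = - F * (real k * d) - \<bar>l\<bar> * (real k * d)" by (simp add: algebra_simps)
      also have "\<dots> \<le> A 0 (real k * d) \<omega> - l * (real k * d)"
        using A_bounds(2)[of \<omega> 0 "real k * d"] elim kd by (intro diff_mono mult_right_mono) auto
      finally have "?c \<le> Z l d G k \<omega>"
        unfolding Z_def using a by (intro mult_mono) auto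
      then show ?case using k by simp
    qed
  qed
  moreover have "0 < ?c" using a by simp
  ultimately show ?thesis by linarith
qed

lemma Z_full:
  assumes d: "0 < d" and \<psi>: "bdd_borel C \<psi>"
  shows "(\<integral>\<omega>. indicator (space M) \<omega> * Z l d \<psi> k \<omega> \<partial>Px x) = exp (- l * (real k * d)) * T (real k * d) \<psi> x"
  unfolding T_def integral_mult_right_zero[symmetric]
  by (intro Bochner_Integration.integral_cong) (auto simp: Z_def exp_diff exp_minus field_simps)

text \<open>The stopping rule ``stop when \<open>\<theta> = G\<close>, at the latest at step \<open>n\<close>'' is optimal up to
  the discounted value at step \<open>n\<close>, which decays because \<open>l\<close> exceeds the growth rate.\<close>

lemma J_approx:
  assumes d: "0 < d" and G: "bdd_borel C G" and \<theta>: "bdd_borel C \<theta>"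
    and eq: "\<And>z. \<theta> z = max (exp (- l * d) * T d \<theta> z) (G z)"
    and l: "rate Px X f < l" and \<epsilon>: "0 < \<epsilon>"
  shows "\<exists>\<sigma>\<in>dyadic_stopping_times M Px X d x. \<theta> x - \<epsilon> \<le> J l d G \<sigma> x"
proof -
  \<comment> \<open>\<open>E k\<close> says that contact with \<open>G\<close> has not occurred
    before step \<open>k\<close>, \<open>D k\<close> that there is contact at \<open>k\<close>.
    Below, \<open>R\<close> measures the part still running and \<open>S\<close> the payoff
    collected at a first contact.\<close>
  define E where "E k = {\<omega> \<in> space M. \<forall>j<k. \<theta> (X (real j * d) \<omega>) \<noteq> G (X (real j * d) \<omega>)}" for k :: nat
  define D where "D k = {\<omega> \<in> space M. \<theta> (X (real k * d) \<omega>) = G (X (real k * d) \<omega>)}" for k :: nat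
  have DN: "D j \<in> sets (N (real k * d))" if "j \<le> k" for j k
  proof -
    have [measurable]: "X (real j * d) \<in> measurable (N (real k * d)) borel"
      using that d by (intro X_N) (auto intro: mult_right_mono)
    note [measurable] = bdd_borelD(1)[OF G] bdd_borelD(1)[OF \<theta>]
    have "{\<omega> \<in> space (N (real k * d)). \<theta> (X (real j * d) \<omega>) = G (X (real j * d) \<omega>)} \<in> sets (N (real k * d))"
      by measurable
    then show ?thesis by (simp add: D_def)
  qed
  have EN: "E m \<in> sets (N (real k * d))" if "m \<le> Suc k" for m k
  proof -
    have "E m = space (N (real k * d)) - (\<Union>j<m. D j)" by (auto simp: E_def D_def)
    moreover have "(\<Union>j<m. D j) \<in> sets (N (real k * d))" using DN that by (intro sets.finite_UN) auto
    ultimately show ?thesis by (metis sets.compl_sets)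
  qed
  have EM: "E k \<in> sets M" and EDM: "E k \<inter> D k \<in> sets M" for k
    using EN[of k k] DN[of k k] N_subset by (auto intro: sets.Int)
  have E0: "E 0 = space M" by (simp add: E_def)
  have Esplit: "E k = (E k \<inter> D k) \<union> E (Suc k)" "(E k \<inter> D k) \<inter> E (Suc k) = {}" for k
    by (auto simp: E_def D_def less_Suc_eq)
  define R where "R \<psi> k = (\<integral>\<omega>. indicator (E k) \<omega> * Z l d \<psi> k \<omega> \<partial>Px x)" for \<psi> k
  define S where "S k = (\<integral>\<omega>. indicator (E k \<inter> D k) \<omega> * Z l d G k \<omega> \<partial>Px x)" for k
  \<comment> \<open>Off the contact set the maximum in \<open>eq\<close> is the continuation term,
    so the supermartingale inequality becomes an equality until first contact.\<close>
  have ident: "\<theta> x = R \<theta> k + (\<Sum>j<k. S j)" for k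
  proof (induction k)
    case 0
    then show ?case using Z_0[OF \<theta>] by (simp add: R_def E0)
  next
    case (Suc k)
    have "R \<theta> k = (\<integral>\<omega>. indicator (E k \<inter> D k) \<omega> * Z l d \<theta> k \<omega> \<partial>Px x) +
        (\<integral>\<omega>. indicator (E (Suc k)) \<omega> * Z l d \<theta> k \<omega> \<partial>Px x)"
      unfolding R_def by (rule Z_split[OF d \<theta> EDM EM Esplit(2,1)])
    also have "(\<integral>\<omega>. indicator (E k \<inter> D k) \<omega> * Z l d \<theta> k \<omega> \<partial>Px x) = S k"
      unfolding S_def by (intro Bochner_Integration.integral_cong) (auto simp: indicator_def Z_def D_def)
    also have "(\<integral>\<omega>. indicator (E (Suc k)) \<omega> * Z l d \<theta> k \<omega> \<partial>Px x) =
        (\<integral>\<omega>. indicator (E (Suc k)) \<omega> * Z l d (\<lambda>z. exp (- l * d) * T d \<theta> z) k \<omega> \<partial>Px x)"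
    proof (intro Bochner_Integration.integral_cong refl)
      fix \<omega>
      have "\<theta> (X (real k * d) \<omega>) = exp (- l * d) * T d \<theta> (X (real k * d) \<omega>)" if "\<omega> \<in> E (Suc k)"
      proof -
        have "\<theta> (X (real k * d) \<omega>) \<noteq> G (X (real k * d) \<omega>)" using that by (simp add: E_def)
        then show ?thesis using eq[of "X (real k * d) \<omega>"] by (simp add: max_def split: if_splits)
      qed
      then show "indicator (E (Suc k)) \<omega> * Z l d \<theta> k \<omega> =
          indicator (E (Suc k)) \<omega> * Z l d (\<lambda>z. exp (- l * d) * T d \<theta> z) k \<omega>"
        by (simp add: indicator_def Z_def)
    qed
    also have "\<dots> = R \<theta> (Suc k)"
      unfolding R_def using EN by (intro Z_step[OF d \<theta>, symmetric]) auto
    finally show ?case using Suc by simp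
  qed
  \<comment> \<open>The alternative \<open>k = n\<close> is the cap; it also guarantees that the
    least index exists.\<close>
  define \<tau> where "\<tau> n \<omega> = enat (LEAST k. k = n \<or> \<theta> (X (real k * d) \<omega>) = G (X (real k * d) \<omega>))" for n :: nat and \<omega>
  have \<tau>_le: "\<tau> n \<omega> \<le> enat n" for n \<omega>
    unfolding \<tau>_def by (simp add: Least_le)
  have \<tau>_eq: "{\<omega> \<in> space M. \<tau> n \<omega> = enat k} = (if k < n then E k \<inter> D k else if k = n then E n else {})" for n k
  proof -
    have "\<tau> n \<omega> = enat k \<longleftrightarrow> k \<le> n \<and> (k = n \<or> \<theta> (X (real k * d) \<omega>) = G (X (real k * d) \<omega>)) \<and>
        (\<forall>j<k. \<theta> (X (real j * d) \<omega>) \<noteq> G (X (real j * d) \<omega>))" (is "_ \<longleftrightarrow> ?R") for \<omega>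
    proof
      assume "\<tau> n \<omega> = enat k"
      then have k: "k = (LEAST k. k = n \<or> \<theta> (X (real k * d) \<omega>) = G (X (real k * d) \<omega>))" by (simp add: \<tau>_def)
      show ?R unfolding k
        using LeastI[of "\<lambda>k. k = n \<or> \<theta> (X (real k * d) \<omega>) = G (X (real k * d) \<omega>)" n]
          Least_le[of "\<lambda>k. k = n \<or> \<theta> (X (real k * d) \<omega>) = G (X (real k * d) \<omega>)" n]
          not_less_Least[of _ "\<lambda>k. k = n \<or> \<theta> (X (real k * d) \<omega>) = G (X (real k * d) \<omega>)"] by blast
    next
      assume R: ?R
      have "(LEAST k. k = n \<or> \<theta> (X (real k * d) \<omega>) = G (X (real k * d) \<omega>)) = k"
      proof (rule Least_equality)
        fix j assume "j = n \<or> \<theta> (X (real j * d) \<omega>) = G (X (real j * d) \<omega>)"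
        then show "k \<le> j" using R by (meson not_le)
      qed (use R in blast)
      then show "\<tau> n \<omega> = enat k" by (simp add: \<tau>_def)
    qed
    then show ?thesis by (auto simp: E_def D_def)
  qed
  have \<tau>N: "{\<omega> \<in> space M. \<tau> n \<omega> = enat k} \<in> sets (N (real k * d))" for n k
    unfolding \<tau>_eq using EN[of k k] DN[of k k] by auto
  have \<tau>: "\<tau> n \<in> dyadic_stopping_times M Px X d x" for n
    unfolding dyadic_stopping_times_def using \<tau>N \<tau>_le by (auto intro!: exI[of _ n])
  have J\<tau>: "J l d G (\<tau> n) x = R G n + (\<Sum>j<n. S j)" for n
  proof -
    have "J l d G (\<tau> n) x = (\<Sum>k\<le>n. \<integral>\<omega>. indicator {\<omega> \<in> space M. \<tau> n \<omega> = enat k} \<omega> * Z l d G k \<omega> \<partial>Px x)"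
      using \<tau>_le by (intro J_eq_sum(1)[OF d G \<tau>N]) auto
    also have "\<dots> = (\<Sum>k<n. S k) + R G n"
      unfolding \<tau>_eq lessThan_Suc_atMost[symmetric] sum.lessThan_Suc by (simp add: S_def R_def)
    finally show ?thesis by simp
  qed
  \<comment> \<open>The growth bound is taken at an intermediate \<open>l'\<close>, so that
    discounting by \<open>l\<close> leaves the ratio \<open>exp ((l' - l) * d)\<close>, which is
    below 1.\<close>
  obtain l' where l': "rate Px X f < l'" "l' < l" using dense[OF l] by blast
  obtain K where K: "K \<ge> 1" "\<And>t x. 0 \<le> t \<Longrightarrow> T t (\<lambda>_. 1) x \<le> K * exp (l' * t)"
    using T_one_growth[OF l'(1)] by blast
  \<comment> \<open>The value and the reward of the capped rule share all first-contact terms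
    \<open>S\<close>; they differ by \<open>R \<theta> n - R G n\<close> only.\<close>
  have gap: "\<theta> x - J l d G (\<tau> n) x \<le> C * K * exp ((l' - l) * d) ^ n" for n
  proof -
    have nd: "0 \<le> real n * d" using d by simp
    note C = bdd_borelD(4)[OF \<theta>]
    have "0 \<le> R G n" unfolding R_def using Z_bounds[OF d G] by (intro integral_nonneg_AE AE_I2) auto
    then have "\<theta> x - J l d G (\<tau> n) x \<le> R \<theta> n" using J\<tau>[of n] ident[of n] by linarith
    also have "R \<theta> n \<le> (\<integral>\<omega>. indicator (space M) \<omega> * Z l d \<theta> n \<omega> \<partial>Px x)"
      unfolding R_def using Z_bounds[OF d \<theta>] EM
      by (intro integral_mono Z_integrable[OF d \<theta>]) (auto simp: indicator_def)
    also have "\<dots> = exp (- l * (real n * d)) * T (real n * d) \<theta> x" by (rule Z_full[OF d \<theta>])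
    also have "\<dots> \<le> exp (- l * (real n * d)) * (C * (K * exp (l' * (real n * d))))"
      using T_le_T_one[OF nd \<theta>, of x] mult_left_mono[OF K(2)[OF nd, of x] C] by (intro mult_left_mono) auto
    also have "\<dots> = C * K * exp ((l' - l) * d) ^ n"
      by (simp add: exp_of_nat_mult[symmetric] exp_add[symmetric] algebra_simps)
    finally show ?thesis .
  qed
  have "(\<lambda>n. C * K * exp ((l' - l) * d) ^ n) \<longlonglongrightarrow> C * K * 0"
    using l' d by (intro tendsto_intros LIMSEQ_power_zero) (auto simp: mult_neg_pos)
  then have "\<forall>\<^sub>F n in sequentially. C * K * exp ((l' - l) * d) ^ n < \<epsilon>"
    using \<epsilon> by (intro order_tendstoD(2)) auto
  then obtain n where "C * K * exp ((l' - l) * d) ^ n < \<epsilon>"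
    using eventually_happens' sequentially_bot by blast
  with gap[of n] \<tau>[of n] show ?thesis by (intro bexI[of _ "\<tau> n"]) auto
qed

lemma J_exp_eq:
  assumes d: "0 < d"
  shows "J l d (\<lambda>z. exp (h z)) \<sigma> x = (\<integral>\<omega>. (case \<sigma> \<omega> of
      enat k \<Rightarrow> exp (integral {0..real k * d} (\<lambda>s. f (X s \<omega>) - l) + h (X (real k * d) \<omega>)) | \<infinity> \<Rightarrow> 0) \<partial>Px x)"
  unfolding J_def
proof (intro Bochner_Integration.integral_cong refl)
  fix \<omega> assume "\<omega> \<in> space (Px x)"
  then have "Z l d (\<lambda>z. exp (h z)) k \<omega> =
      exp (integral {0..real k * d} (\<lambda>s. f (X s \<omega>) - l) + h (X (real k * d) \<omega>))" for k
    using d by (simp add: integral_path_minus_const Z_def exp_add)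
  then show "(case \<sigma> \<omega> of enat k \<Rightarrow> Z l d (\<lambda>z. exp (h z)) k \<omega> | \<infinity> \<Rightarrow> 0) =
      (case \<sigma> \<omega> of enat k \<Rightarrow> exp (integral {0..real k * d} (\<lambda>s. f (X s \<omega>) - l) + h (X (real k * d) \<omega>)) | \<infinity> \<Rightarrow> 0)"
    by (simp cong: enat.case_cong)
qed

end

subsection \<open>Passage to the limit in the one-step equations\<close>

locale impulse_control = feynman_kac M Px X f F
  for M :: "'w measure" and Px :: "'a::{metric_space, second_countable_topology} \<Rightarrow> 'w measure"
    and X :: "real \<Rightarrow> 'w \<Rightarrow> 'a" and f :: "'a \<Rightarrow> real" and F :: real +
  fixes c :: "'a \<Rightarrow> 'a \<Rightarrow> real" and U :: "'a set" and H :: real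
  assumes U: "compact U" "U \<noteq> {}"
    and c_cont: "continuous_on (UNIV \<times> U) (\<lambda>(x, \<xi>). c x \<xi>)"
    and c_nonpos: "\<And>x \<xi>. \<xi> \<in> U \<Longrightarrow> c x \<xi> \<le> 0" and c_ge: "\<And>x \<xi>. \<xi> \<in> U \<Longrightarrow> - H \<le> c x \<xi>"
begin

text \<open>Compactness of \<open>U\<close> turns joint continuity of \<open>c\<close> into
  continuity in the state that is uniform in the impulse target.\<close>

lemma c_equicontinuous:
  assumes "0 < \<epsilon>"
  shows "\<forall>\<^sub>F y in nhds x. \<forall>\<xi>\<in>U. \<bar>c y \<xi> - c x \<xi>\<bar> \<le> \<epsilon>"
proof -
  obtain S where "x \<in> S" "open S"
    "\<forall>y\<in>S \<inter> UNIV. \<forall>\<xi>\<in>U. dist ((\<lambda>(x, \<xi>). c x \<xi>) (y, \<xi>)) ((\<lambda>(x, \<xi>). c x \<xi>) (x, \<xi>)) \<le> \<epsilon>"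
    by (rule continuous_on_prod_compactE[OF c_cont U(1) UNIV_I[of x] assms])
  then show ?thesis unfolding eventually_nhds by (auto simp: dist_real_def intro!: exI[of _ S])
qed

section \<open>The intervention operator\<close>

lemma Mop_bdd_above:
  assumes "\<And>\<xi>. \<xi> \<in> U \<Longrightarrow> h \<xi> \<le> b"
  shows "bdd_above ((\<lambda>\<xi>. c x \<xi> + h \<xi>) ` U)"
proof (rule bdd_aboveI2[of _ _ b])
  fix \<xi> assume "\<xi> \<in> U"
  from c_nonpos[OF this, of x] assms[OF this] show "c x \<xi> + h \<xi> \<le> b" by linarith
qed

lemma Mop_le:
  assumes "\<And>\<xi>. \<xi> \<in> U \<Longrightarrow> h \<xi> \<le> b"
  shows "Mop c U h x \<le> b"
  unfolding Mop_def
proof (rule cSUP_least[OF U(2)])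
  fix \<xi> assume "\<xi> \<in> U"
  from c_nonpos[OF this, of x] assms[OF this] show "c x \<xi> + h \<xi> \<le> b" by linarith
qed

text \<open>Source of the lower bound that is uniform in \<open>m\<close>: for a function with
  supremum 0 over \<open>U\<close>, the operator \<open>Mop\<close> stays above \<open>- H\<close>
  everywhere.\<close>

lemma Mop_ge:
  assumes "\<And>\<xi>. \<xi> \<in> U \<Longrightarrow> h \<xi> \<le> b"
  shows "(SUP \<xi>\<in>U. h \<xi>) - H \<le> Mop c U h x"
proof -
  have "(SUP \<xi>\<in>U. h \<xi>) \<le> Mop c U h x + H"
  proof (rule cSUP_least[OF U(2)])
    fix \<xi> assume \<xi>: "\<xi> \<in> U"
    have "c x \<xi> + h \<xi> \<le> Mop c U h x"
      unfolding Mop_def by (rule cSUP_upper[OF \<xi> Mop_bdd_above[OF assms]])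
    with c_ge[OF \<xi>, of x] show "h \<xi> \<le> Mop c U h x + H" by linarith
  qed
  then show ?thesis by simp
qed

lemma Mop_diff:
  assumes "\<And>\<xi>. \<xi> \<in> U \<Longrightarrow> h \<xi> \<le> b" "\<And>\<xi>. \<xi> \<in> U \<Longrightarrow> h' \<xi> \<le> b'"
    "\<And>\<xi>. \<xi> \<in> U \<Longrightarrow> \<bar>(c x \<xi> + h \<xi>) - (c y \<xi> + h' \<xi>)\<bar> \<le> e"
  shows "\<bar>Mop c U h x - Mop c U h' y\<bar> \<le> e"
  unfolding Mop_def
  by (rule SUP_diff_le[OF U(2) Mop_bdd_above[OF assms(1)] Mop_bdd_above[OF assms(2)] assms(3)])

lemma Mop_shift:
  assumes "\<And>\<xi>. \<xi> \<in> U \<Longrightarrow> h \<xi> \<le> b"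
  shows "Mop c U (\<lambda>\<xi>. h \<xi> - s) x = Mop c U h x - s"
  using SUP_minus_const[OF U(2) Mop_bdd_above[of h b x, OF assms], of s]
  unfolding Mop_def by (simp add: add_diff_eq)

lemma Mop_continuous:
  assumes "\<And>\<xi>. \<xi> \<in> U \<Longrightarrow> h \<xi> \<le> b"
  shows "continuous_on UNIV (Mop c U h)"
  unfolding continuous_on_eq_continuous_at[OF open_UNIV] isCont_def tendsto_iff dist_real_def
proof (intro ballI allI impI)
  fix x and \<epsilon> :: real assume "0 < \<epsilon>"
  then have "\<forall>\<^sub>F y in nhds x. \<forall>\<xi>\<in>U. \<bar>c y \<xi> - c x \<xi>\<bar> \<le> \<epsilon> / 2" by (intro c_equicontinuous) auto
  then have "\<forall>\<^sub>F y in at x. \<forall>\<xi>\<in>U. \<bar>c y \<xi> - c x \<xi>\<bar> \<le> \<epsilon> / 2"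
    by (simp add: at_within_def eventually_inf_principal eventually_mono)
  then show "\<forall>\<^sub>F y in at x. \<bar>Mop c U h y - Mop c U h x\<bar> < \<epsilon>"
  proof eventually_elim
    case (elim y)
    have "\<bar>Mop c U h y - Mop c U h x\<bar> \<le> \<epsilon> / 2"
      by (rule Mop_diff[OF assms assms]) (use elim in auto)
    then show ?case using \<open>0 < \<epsilon>\<close> by simp
  qed
qed

text \<open>Both terms of the one-step equation commute with subtracting a constant, here the
  supremum of \<open>w\<close> over \<open>U\<close>. Since \<open>w\<close> equals
  \<open>Mop\<close> of itself off \<open>B\<close>, the case distinction under the expectation is
  just \<open>w\<close>, and the expectation becomes a multiple of \<open>T\<close> of
  \<open>exp v\<close>. Borel measurability on the whole space comes from gluing two continuous
  pieces along the closed set \<open>B\<close>.\<close>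

lemma OS_solution_normalised:
  assumes d: "0 < d" and B: "compact B" "U \<subseteq> B" and OS: "OS_solution Px X f c U d B l w"
  obtains v C where "v \<in> borel_measurable borel" "\<And>x. \<bar>v x\<bar> \<le> C"
    "(SUP \<xi>\<in>U. v \<xi>) = 0" "\<And>\<xi>. \<xi> \<in> U \<Longrightarrow> v \<xi> \<le> 0"
    "\<And>x. x \<notin> B \<Longrightarrow> v x = Mop c U v x"
    "\<And>x. x \<in> B \<Longrightarrow> v x = max (ln (T d (\<lambda>z. exp (v z)) x) - l * d) (Mop c U v x)"
proof -
  have "bounded (w ` B)" and wc: "continuous_on B w"
    and w_off: "\<And>x. x \<notin> B \<Longrightarrow> w x = Mop c U w x"
    and w_on: "\<And>x. x \<in> B \<Longrightarrow> w x = max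
        (ln (\<integral>\<omega>. exp (integral {0..d} (\<lambda>s. f (X s \<omega>) - l)
             + (if X d \<omega> \<in> B then w (X d \<omega>) else Mop c U w (X d \<omega>))) \<partial>Px x))
        (Mop c U w x)"
    using OS unfolding OS_solution_def by auto
  then obtain W where W: "\<And>x. x \<in> B \<Longrightarrow> \<bar>w x\<bar> \<le> W" by (auto simp: bounded_iff)
  have wU: "w \<xi> \<le> W" if "\<xi> \<in> U" for \<xi> using W[of \<xi>] B that by auto
  define s where "s = (SUP \<xi>\<in>U. w \<xi>)"
  have bdd: "bdd_above (w ` U)" using wU by (rule bdd_aboveI2)
  define v where "v x = w x - s" for x
  have M: "Mop c U v x = Mop c U w x - s" for x
    unfolding v_def[abs_def] by (rule Mop_shift[OF wU])
  obtain \<xi>0 where \<xi>0: "\<xi>0 \<in> U" using U(2) by auto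
  have sW: "- W \<le> s" "s \<le> W"
  proof -
    have "- W \<le> w \<xi>0" using W[of \<xi>0] \<xi>0 B by auto
    also have "w \<xi>0 \<le> s" unfolding s_def by (rule cSUP_upper[OF \<xi>0 bdd])
    finally show "- W \<le> s" .
    show "s \<le> W" unfolding s_def by (rule cSUP_least[OF U(2) wU])
  qed
  have H: "0 \<le> H" using c_nonpos[OF \<xi>0, of \<xi>0] c_ge[OF \<xi>0, of \<xi>0] by linarith
  have wb: "\<bar>w x\<bar> \<le> W + H" for x
  proof (cases "x \<in> B")
    case True
    then show ?thesis using W[of x] H by linarith
  next
    case False
    have "Mop c U w x \<le> W" by (rule Mop_le[OF wU])
    moreover have "s - H \<le> Mop c U w x" unfolding s_def by (rule Mop_ge[OF wU])
    ultimately show ?thesis using w_off[OF False] sW H by (simp add: abs_le_iff)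
  qed
  have vb: "\<bar>v x\<bar> \<le> 2 * W + H" for x unfolding v_def using wb[of x] sW by linarith
  have "w = (\<lambda>x. if x \<in> B then w x else Mop c U w x)" using w_off by auto
  moreover have "(\<lambda>x. if x \<in> B then w x else Mop c U w x) \<in> borel_measurable borel"
    using B(1) wc Mop_continuous[of w W, OF wU]
    by (intro borel_measurable_continuous_on_if)
      (auto intro: borel_closed compact_imp_closed continuous_on_subset)
  ultimately have [measurable]: "w \<in> borel_measurable borel" by metis
  have vm: "v \<in> borel_measurable borel" unfolding v_def[abs_def] by measurable
  have \<phi>: "bdd_borel (exp (2 * W + H)) (\<lambda>z. exp (v z))"
    using vm vb by (auto simp: bdd_borel_def abs_le_iff)
  have Tpos: "0 < T d (\<lambda>z. exp (v z)) x" for x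
  proof -
    have "exp (- F * d) * exp (- (2 * W + H)) \<le> T d (\<lambda>z. exp (v z)) x"
    proof (rule T_lower[OF less_imp_le[OF d] \<phi>])
      show "exp (- (2 * W + H)) \<le> exp (v z)" for z using vb[of z] by (simp add: abs_le_iff)
    qed simp
    then show ?thesis by (rule less_le_trans[rotated]) simp
  qed
  show ?thesis
  proof (rule that[of v "2 * W + H"])
    show "v x = Mop c U v x" if "x \<notin> B" for x using w_off[OF that] M[of x] by (simp add: v_def)
    show vU: "v \<xi> \<le> 0" if "\<xi> \<in> U" for \<xi> unfolding v_def s_def using cSUP_upper[OF that bdd] by simp
    show "(SUP \<xi>\<in>U. v \<xi>) = 0"
      unfolding v_def SUP_minus_const[OF U(2) bdd] by (simp add: s_def)
    fix x assume x: "x \<in> B"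
    have "(\<integral>\<omega>. exp (integral {0..d} (\<lambda>s. f (X s \<omega>) - l)
             + (if X d \<omega> \<in> B then w (X d \<omega>) else Mop c U w (X d \<omega>))) \<partial>Px x) =
        (\<integral>\<omega>. exp (s - l * d) * (exp (A 0 d \<omega>) * exp (v (X d \<omega>))) \<partial>Px x)"
    proof (intro Bochner_Integration.integral_cong refl)
      fix \<omega> assume "\<omega> \<in> space (Px x)"
      moreover have "(if X d \<omega> \<in> B then w (X d \<omega>) else Mop c U w (X d \<omega>)) = w (X d \<omega>)"
        using w_off by simp
      ultimately show "exp (integral {0..d} (\<lambda>s. f (X s \<omega>) - l)
             + (if X d \<omega> \<in> B then w (X d \<omega>) else Mop c U w (X d \<omega>))) =
          exp (s - l * d) * (exp (A 0 d \<omega>) * exp (v (X d \<omega>)))"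
        using d by (simp add: integral_path_minus_const v_def exp_add[symmetric])
    qed
    also have "\<dots> = exp (s - l * d) * T d (\<lambda>z. exp (v z)) x" by (simp add: T_def)
    finally have "w x = max (ln (exp (s - l * d) * T d (\<lambda>z. exp (v z)) x)) (Mop c U w x)"
      using w_on[OF x] by simp
    moreover have "ln (exp (s - l * d) * T d (\<lambda>z. exp (v z)) x) = s - l * d + ln (T d (\<lambda>z. exp (v z)) x)"
      using Tpos[of x] by (subst ln_mult_pos) simp_all
    ultimately have "w x = max (s - l * d + ln (T d (\<lambda>z. exp (v z)) x)) (Mop c U w x)" by simp
    moreover have "v x = w x - s" by (simp add: v_def)
    ultimately show "v x = max (ln (T d (\<lambda>z. exp (v z)) x) - l * d) (Mop c U v x)"
      unfolding M by linarith
  qed (use vm vb in auto)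
qed

text \<open>Iterating the inequality bounds \<open>\<phi>\<close> by the discounted sum of
  \<open>T\<close> applied to 1, plus a remainder proportional to \<open>C\<close>. The growth bound
  makes the sum geometric and the remainder vanish, so \<open>C\<close> leaves no trace. The ratio
  uses \<open>l0\<close> instead of \<open>l\<close>, which gives one bound for all \<open>l\<close>
  above \<open>l0\<close>.\<close>

lemma subsolution_bound:
  assumes d: "0 < d" and \<phi>: "bdd_borel C \<phi>" and le: "\<And>x. \<phi> x \<le> 1 + exp (- l * d) * T d \<phi> x"
    and K: "1 \<le> K" "\<And>t x. 0 \<le> t \<Longrightarrow> T t (\<lambda>_. 1) x \<le> K * exp (l' * t)" and l: "l' < l0" "l0 \<le> l"
  shows "\<phi> x \<le> K / (1 - exp ((l' - l0) * d))"
proof -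
  define q where "q = exp ((l' - l0) * d)"
  have q: "0 < q" "q < 1" using l d by (auto simp: q_def mult_neg_pos)
  note C = bdd_borelD(4)[OF \<phi>]
  have T1: "exp (- l * d) ^ k * T (real k * d) (\<lambda>_. 1) x \<le> K * q ^ k" for k
  proof -
    have kd: "0 \<le> real k * d" using d by simp
    have "exp (- l * d) ^ k * T (real k * d) (\<lambda>_. 1) x \<le> exp (- l * d) ^ k * (K * exp (l' * (real k * d)))"
      by (intro mult_left_mono K kd) simp
    also have "\<dots> = K * exp ((l' - l) * d) ^ k"
      by (simp add: exp_of_nat_mult[symmetric] exp_add[symmetric] algebra_simps)
    also have "\<dots> \<le> K * q ^ k"
      unfolding q_def using K l d by (intro mult_left_mono power_mono) auto
    finally show ?thesis .
  qed
  have iter: "\<phi> x \<le> (\<Sum>k<n. exp (- l * d) ^ k * T (real k * d) (\<lambda>_. 1) x) + exp (- l * d) ^ n * T (real n * d) \<phi> x" for n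
  proof (induction n)
    case 0
    then show ?case using AE_start_integral[OF bdd_borelD(1)[OF \<phi>], of x] by (simp add: T_def A_def)
  next
    case (Suc n)
    have nd: "0 \<le> real n * d" using d by simp
    have T\<phi>: "bdd_borel C (T d \<phi>)" using d by (intro bdd_borel_T[OF _ \<phi>]) simp
    have T\<phi>': "bdd_borel (exp (- l * d) * C) (\<lambda>z. exp (- l * d) * T d \<phi> z)"
      using bdd_borelD[OF T\<phi>] by (auto simp: bdd_borel_def)
    have T\<phi>'': "bdd_borel (1 + exp (- l * d) * C) (\<lambda>z. 1 + exp (- l * d) * T d \<phi> z)"
      using bdd_borelD[OF T\<phi>'] by (auto simp: bdd_borel_def)
    have "T (real n * d) \<phi> x \<le> T (real n * d) (\<lambda>z. 1 + exp (- l * d) * T d \<phi> z) x"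
      by (rule T_mono[OF nd \<phi> T\<phi>'' le])
    also have "\<dots> = T (real n * d) (\<lambda>_. 1) x + exp (- l * d) * T (real n * d) (T d \<phi>) x"
      using T_add[OF nd bdd_borel_one T\<phi>', of x] by (simp only: T_cmult)
    also have "T (real n * d) (T d \<phi>) x = T (real (Suc n) * d) \<phi> x"
      using T_semigroup[OF nd less_imp_le[OF d] \<phi>, of x] by (simp add: algebra_simps)
    finally have "exp (- l * d) ^ n * T (real n * d) \<phi> x \<le>
        exp (- l * d) ^ n * (T (real n * d) (\<lambda>_. 1) x + exp (- l * d) * T (real (Suc n) * d) \<phi> x)"
      by (intro mult_left_mono) simp_all
    then show ?case using Suc by (simp add: algebra_simps)
  qed
  have bound: "\<phi> x \<le> K / (1 - q) + C * (K * q ^ n)" for n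
  proof -
    have "(\<Sum>k<n. exp (- l * d) ^ k * T (real k * d) (\<lambda>_. 1) x) \<le> (\<Sum>k<n. K * q ^ k)"
      by (intro sum_mono T1)
    also have "\<dots> = K * ((1 - q ^ n) / (1 - q))"
      using q by (simp add: sum_distrib_left[symmetric] sum_gp_strict)
    also have "\<dots> \<le> K * (1 / (1 - q))"
      using q K by (intro mult_left_mono divide_right_mono) auto
    finally have 1: "(\<Sum>k<n. exp (- l * d) ^ k * T (real k * d) (\<lambda>_. 1) x) \<le> K / (1 - q)" by simp
    have "exp (- l * d) ^ n * T (real n * d) \<phi> x \<le> exp (- l * d) ^ n * (C * T (real n * d) (\<lambda>_. 1) x)"
      using d by (intro mult_left_mono T_le_T_one[OF _ \<phi>]) auto
    also have "\<dots> = C * (exp (- l * d) ^ n * T (real n * d) (\<lambda>_. 1) x)" by simp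
    also have "\<dots> \<le> C * (K * q ^ n)" by (intro mult_left_mono T1 C)
    finally show ?thesis using 1 iter[of n] by linarith
  qed
  have "(\<lambda>n. K / (1 - q) + C * (K * q ^ n)) \<longlonglongrightarrow> K / (1 - q) + C * (K * 0)"
    using q by (intro tendsto_intros LIMSEQ_power_zero) auto
  then show ?thesis unfolding q_def[symmetric] using bound by (intro LIMSEQ_le_const) auto
qed

lemma OS_limit_solution:
  assumes d: "0 < d" and B: "\<And>m. compact (B m)" "U \<subseteq> B 0" "\<And>m. B m \<subseteq> B (Suc m)" "(\<Union>m. B m) = UNIV"
    and OS: "\<And>m. OS_solution Px X f c U d (B m) (lam m) (w m)"
    and lim: "lam \<longlonglongrightarrow> L" and gt: "rate Px X f < L"
  obtains g V where "continuous_on UNIV g" "\<And>x. \<bar>g x\<bar> \<le> V" "(SUP \<xi>\<in>U. g \<xi>) = 0" "\<And>\<xi>. \<xi> \<in> U \<Longrightarrow> g \<xi> \<le> 0"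
    "\<And>x. g x = max (ln (T d (\<lambda>z. exp (g z)) x) - L * d) (Mop c U g x)"
proof -
  have d0: "0 \<le> d" using d by simp
  have B_mono: "B m \<subseteq> B n" if "m \<le> n" for m n using B(3) that by (rule lift_Suc_mono_le)
  have UB: "U \<subseteq> B m" for m using B(2) B_mono[of 0 m] by auto
  \<comment> \<open>Two intermediate levels: \<open>l'\<close> bounds the growth of
    \<open>T\<close>, and \<open>l0\<close> lies below \<open>lam m\<close> from some
    \<open>m0\<close> on; their gap supplies a geometric ratio common to all later
    \<open>m\<close>.\<close>
  obtain l' where l': "rate Px X f < l'" "l' < L" using dense[OF gt] by blast
  obtain l0 where l0: "l' < l0" "l0 < L" using dense[OF l'(2)] by blast
  obtain K where K: "1 \<le> K" "\<And>t x. 0 \<le> t \<Longrightarrow> T t (\<lambda>_. 1) x \<le> K * exp (l' * t)"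
    using T_one_growth[OF l'(1)] by blast
  have "\<forall>\<^sub>F m in sequentially. l0 < lam m" using lim l0(2) by (rule order_tendstoD)
  then obtain m0 where m0: "\<And>m. m \<ge> m0 \<Longrightarrow> l0 < lam m" unfolding eventually_sequentially by blast
  have "\<exists>v. v \<in> borel_measurable borel \<and> (\<exists>C. \<forall>x. \<bar>v x\<bar> \<le> C) \<and>
    (SUP \<xi>\<in>U. v \<xi>) = 0 \<and> (\<forall>\<xi>\<in>U. v \<xi> \<le> 0) \<and> (\<forall>x. x \<notin> B m \<longrightarrow> v x = Mop c U v x) \<and>
    (\<forall>x\<in>B m. v x = max (ln (T d (\<lambda>z. exp (v z)) x) - lam m * d) (Mop c U v x))" for m
    by (rule OS_solution_normalised[OF d B(1) UB OS[of m]]) blast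
  then obtain v where v: "\<And>m. v m \<in> borel_measurable borel" "\<And>m. \<exists>C. \<forall>x. \<bar>v m x\<bar> \<le> C"
    "\<And>m. (SUP \<xi>\<in>U. v m \<xi>) = 0" "\<And>m \<xi>. \<xi> \<in> U \<Longrightarrow> v m \<xi> \<le> 0"
    "\<And>m x. x \<notin> B m \<Longrightarrow> v m x = Mop c U (v m) x"
    "\<And>m x. x \<in> B m \<Longrightarrow> v m x = max (ln (T d (\<lambda>z. exp (v m z)) x) - lam m * d) (Mop c U (v m) x)"
    by metis
  define u where "u n = v (m0 + n)" for n
  define k where "k n = lam (m0 + n)" for n
  have kL: "k \<longlonglongrightarrow> L" unfolding k_def using LIMSEQ_ignore_initial_segment[OF lim, of m0] by (simp add: add.commute)
  have u_eq: "u n x = max (ln (T d (\<lambda>z. exp (u n z)) x) - k n * d) (Mop c U (u n) x)" if "x \<in> B (m0 + n)" for n x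
    unfolding u_def k_def by (rule v(6)[OF that])
  have uU: "u n \<xi> \<le> 0" if "\<xi> \<in> U" for n \<xi> using v(4)[OF that] by (simp add: u_def)
  have Mu: "- H \<le> Mop c U (u n) x" "Mop c U (u n) x \<le> 0" for n x
    using Mop_ge[of "u n" 0 x, OF uU] Mop_le[of "u n" 0 x, OF uU] v(3)[of "m0 + n"] by (auto simp: u_def)
  have H: "0 \<le> H" using Mu[of 0 undefined] by linarith
  define Q where "Q = K / (1 - exp ((l' - l0) * d))"
  have Q: "1 \<le> Q"
  proof -
    have "exp ((l' - l0) * d) < 1" using l0 d by (simp add: mult_neg_pos)
    then have "1 - exp ((l' - l0) * d) \<le> K" "0 < 1 - exp ((l' - l0) * d)"
      using K(1) exp_gt_zero[of "(l' - l0) * d"] by linarith+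
    then show ?thesis by (simp add: Q_def)
  qed
  define V where "V = H + ln Q"
  have uV: "\<bar>u n x\<bar> \<le> V" for n x
  proof -
    \<comment> \<open>This bound may depend on \<open>n\<close>; it only makes the integrals finite
      and is then replaced by the uniform \<open>Q\<close>.\<close>
    obtain C where C: "\<And>x. \<bar>u n x\<bar> \<le> C" using v(2) unfolding u_def by blast
    have \<phi>: "bdd_borel (exp C) (\<lambda>z. exp (u n z))"
      using v(1) C unfolding u_def bdd_borel_def by (auto simp: abs_le_iff)
    have Tpos: "0 < T d (\<lambda>z. exp (u n z)) x" for x
    proof -
      have "exp (- F * d) * exp (- C) \<le> T d (\<lambda>z. exp (u n z)) x"
      proof (rule T_lower[OF d0 \<phi>])
        show "exp (- C) \<le> exp (u n z)" for z using C[of z] by (simp add: abs_le_iff)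
      qed simp
      then show ?thesis by (rule less_le_trans[rotated]) simp
    qed
    \<comment> \<open>The inequality holds off the compact set too: there \<open>u n\<close> equals
      \<open>Mop c U (u n)\<close>, which is non-positive by the normalisation.\<close>
    have sub: "exp (u n x) \<le> 1 + exp (- k n * d) * T d (\<lambda>z. exp (u n z)) x" for x
    proof (cases "x \<in> B (m0 + n)")
      case True
      have "exp (u n x) = max (exp (ln (T d (\<lambda>z. exp (u n z)) x) - k n * d)) (exp (Mop c U (u n) x))"
        by (subst u_eq[OF True]) (simp add: max_def)
      also have "exp (ln (T d (\<lambda>z. exp (u n z)) x) - k n * d) = exp (- k n * d) * T d (\<lambda>z. exp (u n z)) x"
        using Tpos[of x] by (simp add: exp_diff exp_minus field_simps)
      also have "max (exp (- k n * d) * T d (\<lambda>z. exp (u n z)) x) (exp (Mop c U (u n) x)) \<le>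
          max (exp (- k n * d) * T d (\<lambda>z. exp (u n z)) x) 1"
        using Mu(2)[of n x] by (intro max.mono) auto
      also have "\<dots> \<le> 1 + exp (- k n * d) * T d (\<lambda>z. exp (u n z)) x"
        using Tpos[of x] by (simp add: less_imp_le)
      finally show ?thesis .
    next
      case False
      then have "exp (u n x) \<le> 1" using v(5)[OF False] Mu(2)[of n x] by (simp add: u_def)
      moreover have "0 \<le> exp (- k n * d) * T d (\<lambda>z. exp (u n z)) x" using Tpos[of x] by simp
      ultimately show ?thesis by linarith
    qed
    have "exp (u n x) \<le> Q"
      unfolding Q_def using m0[of "m0 + n"] l0
      by (intro subsolution_bound[OF d \<phi> sub K]) (auto simp: k_def)
    then have "u n x \<le> ln Q" using Q by (simp add: ln_ge_iff)
    moreover have "- H \<le> u n x"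
    proof (cases "x \<in> B (m0 + n)")
      case True
      show ?thesis using u_eq[OF True] Mu(1)[of n x] by linarith
    next
      case False
      show ?thesis using v(5)[OF False] Mu(1)[of n x] by (simp add: u_def)
    qed
    moreover have "0 \<le> ln Q" using Q by simp
    ultimately show ?thesis unfolding V_def using H by linarith
  qed
  have \<phi>: "bdd_borel (exp V) (\<lambda>z. exp (u n z))" for n
    using v(1) uV unfolding u_def bdd_borel_def by (auto simp: abs_le_iff)
  \<comment> \<open>A common positive lower bound for the arguments of \<open>ln\<close>; on the
    values above \<open>a\<close>, the logarithm is Lipschitz with constant
    \<open>1 / a\<close>.\<close>
  define a where "a = exp (- F * d) * exp (- V)"
  have a: "0 < a" by (simp add: a_def)
  have Ta: "a \<le> T d (\<lambda>z. exp (h z)) x" if "bdd_borel (exp V) (\<lambda>z. exp (h z))" "\<And>z. \<bar>h z\<bar> \<le> V" for h x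
    unfolding a_def
  proof (rule T_lower[OF d0 that(1)])
    show "exp (- V) \<le> exp (h z)" for z using that(2)[of z] by (simp add: abs_le_iff)
  qed simp
  \<comment> \<open>Equicontinuous on the whole space because \<open>T\<close> and \<open>c\<close>
    are, with no continuity of \<open>u n\<close> required; it agrees with \<open>u n\<close> on
    \<open>B (m0 + n)\<close>.\<close>
  define vh where "vh n x = max (ln (T d (\<lambda>z. exp (u n z)) x) - k n * d) (Mop c U (u n) x)" for n x
  have u_vh: "u n x = vh n x" if "x \<in> B (m0 + n)" for n x
    unfolding vh_def by (rule u_eq[OF that])
  obtain S where S: "\<And>n. \<bar>k n\<bar> \<le> S"
    using convergent_imp_Bseq[OF convergentI[OF kL]] unfolding Bseq_def real_norm_def by blast
  have vh_bd: "\<bar>vh n x\<bar> \<le> F * d + V + S * d + H" for n x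
  proof -
    have "ln a \<le> ln (T d (\<lambda>z. exp (u n z)) x)" using Ta[OF \<phi> uV, of n x] a by simp
    then have 1: "- F * d - V \<le> ln (T d (\<lambda>z. exp (u n z)) x)" by (simp add: a_def ln_mult)
    have "T d (\<lambda>z. exp (u n z)) x \<le> exp V" using bdd_borelD(3)[OF bdd_borel_T[OF d0 \<phi>]] .
    then have "ln (T d (\<lambda>z. exp (u n z)) x) \<le> ln (exp V)"
      using Ta[OF \<phi> uV, of n x] a by (intro ln_mono) auto
    then have 2: "ln (T d (\<lambda>z. exp (u n z)) x) \<le> V" by simp
    have 3: "\<bar>k n * d\<bar> \<le> S * d" using S[of n] d by (simp add: abs_mult)
    have "0 \<le> F * d" using F_nonneg d by simp
    moreover have "0 \<le> V" using uV[of 0 x] by linarith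
    ultimately show ?thesis unfolding vh_def using 1 2 3 Mu[of n x] H by (simp add: abs_le_iff max_def)
  qed
  have vh_eq: "\<forall>\<^sub>F y in nhds x. \<forall>n. \<bar>vh n y - vh n x\<bar> \<le> \<epsilon>" if \<epsilon>: "0 < \<epsilon>" for x \<epsilon>
  proof -
    have "\<forall>\<^sub>F y in nhds x. \<forall>\<phi>. bdd_borel (exp V) \<phi> \<longrightarrow> \<bar>T d \<phi> y - T d \<phi> x\<bar> \<le> \<epsilon> * a"
      using \<epsilon> a by (intro T_equicontinuous d) auto
    moreover note c_equicontinuous[OF \<epsilon>, of x]
    ultimately show ?thesis
    proof eventually_elim
      case (elim y)
      show ?case
      proof
        fix n
        have "\<bar>ln (T d (\<lambda>z. exp (u n z)) y) - ln (T d (\<lambda>z. exp (u n z)) x)\<bar> \<le>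
            \<bar>T d (\<lambda>z. exp (u n z)) y - T d (\<lambda>z. exp (u n z)) x\<bar> / a"
          by (intro abs_ln_diff_le a Ta[OF \<phi> uV])
        also have "\<dots> \<le> \<epsilon> * a / a" using elim(1) \<phi>[of n] a by (intro divide_right_mono) auto
        also have "\<dots> = \<epsilon>" using a by simp
        finally have 1: "\<bar>ln (T d (\<lambda>z. exp (u n z)) y) - ln (T d (\<lambda>z. exp (u n z)) x)\<bar> \<le> \<epsilon>" .
        have 2: "\<bar>Mop c U (u n) y - Mop c U (u n) x\<bar> \<le> \<epsilon>"
          by (rule Mop_diff[OF uU uU]) (use elim(2) in auto)
        show "\<bar>vh n y - vh n x\<bar> \<le> \<epsilon>" unfolding vh_def using 1 2 by linarith
      qed
    qed
  qed
  obtain r g where r: "strict_mono (r :: nat \<Rightarrow> nat)" and g_cont: "continuous_on UNIV g"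
    and vh_lim: "\<And>x. (\<lambda>n. vh (r n) x) \<longlonglongrightarrow> g x"
    using equicontinuous_pointwise_subsequence[of vh, OF vh_bd vh_eq] by blast
  \<comment> \<open>Each fixed point eventually lies in the growing sets, so pointwise limits of
    \<open>vh\<close> and of \<open>u\<close> along the subsequence coincide.\<close>
  have ev_B: "\<forall>\<^sub>F n in sequentially. x \<in> B (m0 + r n)" for x
  proof -
    obtain j where j: "x \<in> B j" using B(4) by blast
    show ?thesis using eventually_ge_at_top[of j]
    proof eventually_elim
      case (elim n)
      have "j \<le> m0 + r n" using elim seq_suble[OF r, of n] by linarith
      then show ?case using B_mono j by blast
    qed
  qed
  have u_lim: "(\<lambda>n. u (r n) x) \<longlonglongrightarrow> g x" for x
    using vh_lim by (rule Lim_transform_eventually)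
      (use ev_B[of x] in \<open>auto elim!: eventually_mono simp: u_vh\<close>)
  have gV: "\<bar>g x\<bar> \<le> V" for x
    by (rule LIMSEQ_le_const2[OF tendsto_rabs[OF u_lim]]) (use uV in auto)
  have gU: "g \<xi> \<le> 0" if "\<xi> \<in> U" for \<xi>
    by (rule LIMSEQ_le_const2[OF u_lim]) (use uU that in auto)
  have unif: "\<forall>\<^sub>F n in sequentially. \<forall>\<xi>\<in>U. \<bar>u (r n) \<xi> - g \<xi>\<bar> \<le> \<epsilon>" if \<epsilon>: "0 < \<epsilon>" for \<epsilon>
  proof -
    have "\<forall>\<^sub>F n in sequentially. \<forall>\<xi>\<in>U. \<bar>vh (r n) \<xi> - g \<xi>\<bar> \<le> \<epsilon>"
    proof (rule equicontinuous_pointwise_imp_uniform[OF _ vh_lim U(1) \<epsilon>])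
      fix x and \<epsilon> :: real assume "0 < \<epsilon>"
      from vh_eq[OF this, of x] show "\<forall>\<^sub>F y in nhds x. \<forall>n. \<bar>vh (r n) y - vh (r n) x\<bar> \<le> \<epsilon>"
        by (rule eventually_mono) blast
    qed
    \<comment> \<open>\<open>U\<close> lies in every \<open>B m\<close>, so on \<open>U\<close> the
      identification is exact for all \<open>n\<close> and uniform convergence transfers.\<close>
    moreover have "u (r n) \<xi> = vh (r n) \<xi>" if "\<xi> \<in> U" for n \<xi> using UB that by (intro u_vh) auto
    ultimately show ?thesis by simp
  qed
  have M_lim: "(\<lambda>n. Mop c U (u (r n)) x) \<longlonglongrightarrow> Mop c U g x" for x
    unfolding tendsto_iff dist_real_def
  proof (intro allI impI)
    fix \<epsilon> :: real assume \<epsilon>: "0 < \<epsilon>"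
    then have "\<forall>\<^sub>F n in sequentially. \<forall>\<xi>\<in>U. \<bar>u (r n) \<xi> - g \<xi>\<bar> \<le> \<epsilon> / 2" by (intro unif) simp
    then show "\<forall>\<^sub>F n in sequentially. \<bar>Mop c U (u (r n)) x - Mop c U g x\<bar> < \<epsilon>"
    proof eventually_elim
      case (elim n)
      have "\<bar>Mop c U (u (r n)) x - Mop c U g x\<bar> \<le> \<epsilon> / 2"
        by (rule Mop_diff[OF uU gU]) (use elim in auto)
      then show ?case using \<epsilon> by simp
    qed
  qed
  have g_sup: "(SUP \<xi>\<in>U. g \<xi>) = 0"
  proof -
    have "\<bar>SUP \<xi>\<in>U. g \<xi>\<bar> \<le> 0 + \<epsilon>" if \<epsilon>: "0 < \<epsilon>" for \<epsilon>
    proof -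
      obtain n where n: "\<forall>\<xi>\<in>U. \<bar>u (r n) \<xi> - g \<xi>\<bar> \<le> \<epsilon>"
        using eventually_happens'[OF sequentially_bot unif[OF \<epsilon>]] by blast
      have "\<bar>(SUP \<xi>\<in>U. u (r n) \<xi>) - (SUP \<xi>\<in>U. g \<xi>)\<bar> \<le> \<epsilon>"
        using n uU gU by (intro SUP_diff_le[OF U(2)] bdd_aboveI2[of _ _ 0]) auto
      moreover have "(SUP \<xi>\<in>U. u (r n) \<xi>) = 0" unfolding u_def by (rule v(3))
      ultimately show ?thesis by simp
    qed
    then have "\<bar>SUP \<xi>\<in>U. g \<xi>\<bar> \<le> 0" by (rule field_le_epsilon)
    then show ?thesis by simp
  qed
  have g\<phi>: "bdd_borel (exp V) (\<lambda>z. exp (g z))"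
  proof -
    have [measurable]: "g \<in> borel_measurable borel" using g_cont by (rule borel_measurable_continuous_onI)
    show ?thesis using gV by (auto simp: bdd_borel_def abs_le_iff)
  qed
  have "g x = max (ln (T d (\<lambda>z. exp (g z)) x) - L * d) (Mop c U g x)" for x
  proof (rule LIMSEQ_unique[OF vh_lim])
    have "(\<lambda>n. T d (\<lambda>z. exp (u (r n) z)) x) \<longlonglongrightarrow> T d (\<lambda>z. exp (g z)) x"
      by (intro T_tendsto[OF d0 \<phi> g\<phi>] tendsto_exp u_lim)
    moreover have "(\<lambda>n. k (r n)) \<longlonglongrightarrow> L" using LIMSEQ_subseq_LIMSEQ[OF kL r] by (simp add: comp_def)
    moreover have "T d (\<lambda>z. exp (g z)) x \<noteq> 0" using Ta[OF g\<phi> gV, of x] a by linarith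
    ultimately show "(\<lambda>n. vh (r n) x) \<longlonglongrightarrow> max (ln (T d (\<lambda>z. exp (g z)) x) - L * d) (Mop c U g x)"
      unfolding vh_def by (intro tendsto_max tendsto_diff tendsto_ln tendsto_mult tendsto_const M_lim)
  qed
  with g_cont gV g_sup gU that show ?thesis by blast
qed

text \<open>After exponentiation the equation reads
  \<open>\<theta> z = max (exp (- L * d) * T d \<theta> z) (G z)\<close>, a dynamic programming
  equation with linear continuation term. \<open>J_le\<close> gives one inequality,
  \<open>J_approx\<close> the other, and \<open>J_pos\<close> permits returning to
  logarithms.\<close>

lemma solution_eq_SUP:
  assumes d: "0 < d" and L: "rate Px X f < L"
    and g: "g \<in> borel_measurable borel" "\<And>x. \<bar>g x\<bar> \<le> V" "\<And>\<xi>. \<xi> \<in> U \<Longrightarrow> g \<xi> \<le> 0"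
    and eq: "\<And>x. g x = max (ln (T d (\<lambda>z. exp (g z)) x) - L * d) (Mop c U g x)"
  shows "g x = (SUP \<sigma>\<in>dyadic_stopping_times M Px X d x. ln (J L d (\<lambda>z. exp (Mop c U g z)) \<sigma> x))"
proof -
  have d0: "0 \<le> d" using d by simp
  define \<theta> where "\<theta> z = exp (g z)" for z
  define G where "G z = exp (Mop c U g z)" for z
  have \<theta>: "bdd_borel (exp V) \<theta>"
    using g by (auto simp: bdd_borel_def \<theta>_def[abs_def] abs_le_iff)
  have Tpos: "0 < T d \<theta> z" for z
  proof -
    have "exp (- F * d) * exp (- V) \<le> T d \<theta> z"
    proof (rule T_lower[OF d0 \<theta>])
      show "exp (- V) \<le> \<theta> z" for z using g(2)[of z] by (simp add: \<theta>_def abs_le_iff)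
    qed simp
    then show ?thesis by (rule less_le_trans[rotated]) simp
  qed
  have \<theta>_eq: "\<theta> z = max (exp (- L * d) * T d \<theta> z) (G z)" for z
  proof -
    have "exp (g z) = max (exp (ln (T d \<theta> z) - L * d)) (exp (Mop c U g z))"
      by (subst eq) (simp add: max_def \<theta>_def[abs_def])
    also have "exp (ln (T d \<theta> z) - L * d) = exp (- L * d) * T d \<theta> z"
      using Tpos[of z] by (simp add: exp_diff exp_minus field_simps)
    finally show ?thesis by (simp add: \<theta>_def G_def)
  qed
  then have le: "G z \<le> \<theta> z" "exp (- L * d) * T d \<theta> z \<le> \<theta> z" for z
    by (metis max.cobounded2, metis max.cobounded1)
  have Mc: "continuous_on UNIV (Mop c U g)" by (rule Mop_continuous[OF g(3)])
  have G: "bdd_borel (exp V) G"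
  proof -
    have [measurable]: "Mop c U g \<in> borel_measurable borel" using Mc by (rule borel_measurable_continuous_onI)
    have "G \<in> borel_measurable borel" unfolding G_def[abs_def] by measurable
    moreover have "0 \<le> G z" "G z \<le> exp V" for z
      using order_trans[OF le(1) bdd_borelD(3)[OF \<theta>]] by (auto simp: G_def)
    ultimately show ?thesis by (simp add: bdd_borel_def)
  qed
  have G_ge: "exp ((SUP \<xi>\<in>U. g \<xi>) - H) \<le> G z" for z
    unfolding G_def by (simp add: Mop_ge[OF g(3)])
  have "(SUP \<sigma>\<in>dyadic_stopping_times M Px X d x. ln (J L d G \<sigma> x)) = g x"
  proof (rule cSup_eq_non_empty)
    show "(\<lambda>\<sigma>. ln (J L d G \<sigma> x)) ` dyadic_stopping_times M Px X d x \<noteq> {}"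
      using J_approx[OF d G \<theta> \<theta>_eq L, of 1 x] by auto
  next
    fix y assume "y \<in> (\<lambda>\<sigma>. ln (J L d G \<sigma> x)) ` dyadic_stopping_times M Px X d x"
    then obtain \<sigma> where \<sigma>: "\<sigma> \<in> dyadic_stopping_times M Px X d x" and y: "y = ln (J L d G \<sigma> x)" by auto
    have "0 < J L d G \<sigma> x" by (rule J_pos[OF d G _ G_ge \<sigma>]) simp
    then have "ln (J L d G \<sigma> x) \<le> ln (\<theta> x)"
      using J_le[OF d G \<theta> le \<sigma>] by (intro ln_mono) auto
    then show "y \<le> g x" by (simp add: y \<theta>_def)
  next
    fix y assume y: "\<And>z. z \<in> (\<lambda>\<sigma>. ln (J L d G \<sigma> x)) ` dyadic_stopping_times M Px X d x \<Longrightarrow> z \<le> y"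
    \<comment> \<open>The approximation error is additive for the exponentiated value, so
      \<open>\<epsilon>\<close> is removed before taking the logarithm.\<close>
    have "\<theta> x \<le> exp y + \<epsilon>" if \<epsilon>: "0 < \<epsilon>" for \<epsilon>
    proof -
      obtain \<sigma> where \<sigma>: "\<sigma> \<in> dyadic_stopping_times M Px X d x" "\<theta> x - \<epsilon> \<le> J L d G \<sigma> x"
        using J_approx[OF d G \<theta> \<theta>_eq L \<epsilon>] by blast
      have "0 < J L d G \<sigma> x" by (rule J_pos[OF d G _ G_ge \<sigma>(1)]) simp
      then have "J L d G \<sigma> x = exp (ln (J L d G \<sigma> x))" by simp
      also have "\<dots> \<le> exp y" using y \<sigma>(1) by simp
      finally show ?thesis using \<sigma>(2) by linarith
    qed
    then have "\<theta> x \<le> exp y" by (rule field_le_epsilon)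
    then show "g x \<le> y" by (simp add: \<theta>_def)
  qed
  then show ?thesis unfolding G_def[abs_def] by simp
qed

end

theorem theorem4p2:
  fixes M :: "'w measure" and Px :: "'a::{metric_space, second_countable_topology} \<Rightarrow> 'w measure"
    and X :: "real \<Rightarrow> 'w \<Rightarrow> 'a"
    and f :: "'a \<Rightarrow> real" and c :: "'a \<Rightarrow> 'a \<Rightarrow> real" and U :: "'a set"
    and B :: "nat \<Rightarrow> 'a set" and \<delta> :: real
    and lam :: "nat \<Rightarrow> real" and w :: "nat \<Rightarrow> 'a \<Rightarrow> real" and lam\<delta> :: real
  assumes E: "locally_compact_space (euclidean :: 'a topology)"
    and proc: "standard_Feller_Markov M Px X"
    and U: "compact U" "U \<noteq> {}"
    and B: "\<And>m. compact (B m)" "U \<subseteq> B 0" "\<And>m. B m \<subseteq> B (Suc m)" "(\<Union>m. B m) = UNIV"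
    and A1: "A1 f c U" and A2: "A2 Px X" and A3: "A3 Px X" and A4: "A4 Px X B"
    and \<delta>: "\<delta> > 0"
    and OS: "\<And>m. OS_solution Px X f c U \<delta> (B m) (lam m) (w m)"
    and lim: "lam \<longlonglongrightarrow> lam\<delta>"
    and gt: "lam\<delta> > rate Px X f"
  shows "\<exists>w\<delta>\<in>Cb. (SUP \<xi>\<in>U. w\<delta> \<xi>) = 0 \<and>
    (\<forall>x. w\<delta> x = (SUP \<sigma>\<in>dyadic_stopping_times M Px X \<delta> x.
       ln (integral\<^sup>L (Px x) (\<lambda>\<omega>. case \<sigma> \<omega> of
            enat k \<Rightarrow> exp (integral {0..real k * \<delta>} (\<lambda>s. f (X s \<omega>) - lam\<delta>)
                          + Mop c U w\<delta> (X (real k * \<delta>) \<omega>))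
          | \<infinity> \<Rightarrow> 0))))"
proof -
  have "bounded (range f)" "bounded ((\<lambda>(x, \<xi>). c x \<xi>) ` (UNIV \<times> U))"
    using A1 unfolding A1_def by auto
  then have "\<exists>F. \<forall>x. \<bar>f x\<bar> \<le> F" "\<exists>H. \<forall>x. \<forall>\<xi>\<in>U. \<bar>c x \<xi>\<bar> \<le> H"
    unfolding bounded_iff by auto
  then obtain F H where F: "\<And>x. \<bar>f x\<bar> \<le> F" and H: "\<And>x \<xi>. \<xi> \<in> U \<Longrightarrow> \<bar>c x \<xi>\<bar> \<le> H"
    by blast
  interpret impulse_control M Px X f F c U H
  proof
    show "- F \<le> f x" for x using F[of x] by (simp add: abs_le_iff)
    show "- H \<le> c x \<xi>" if "\<xi> \<in> U" for x \<xi> using H[OF that, of x] by (simp add: abs_le_iff)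
  qed (use proc A2 U A1 in \<open>auto simp: A1_def\<close>)
  obtain g V where g: "continuous_on UNIV g" "\<And>x. \<bar>g x\<bar> \<le> V" "(SUP \<xi>\<in>U. g \<xi>) = 0" "\<And>\<xi>. \<xi> \<in> U \<Longrightarrow> g \<xi> \<le> 0"
    "\<And>x. g x = max (ln (T \<delta> (\<lambda>z. exp (g z)) x) - lam\<delta> * \<delta>) (Mop c U g x)"
    by (rule OS_limit_solution[OF \<delta> B OS lim gt]) (rule that)
  show ?thesis
  proof (intro bexI[of _ g] conjI allI)
    show "g \<in> Cb" using g(1,2) by (auto simp: Cb_def bounded_iff)
    show "(SUP \<xi>\<in>U. g \<xi>) = 0" by (rule g(3))
    show "g x = (SUP \<sigma>\<in>dyadic_stopping_times M Px X \<delta> x.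
       ln (integral\<^sup>L (Px x) (\<lambda>\<omega>. case \<sigma> \<omega> of
            enat k \<Rightarrow> exp (integral {0..real k * \<delta>} (\<lambda>s. f (X s \<omega>) - lam\<delta>)
                          + Mop c U g (X (real k * \<delta>) \<omega>))
          | \<infinity> \<Rightarrow> 0)))" for x
      using solution_eq_SUP[OF \<delta> gt borel_measurable_continuous_onI[OF g(1)] g(2,4,5), of x]
      unfolding J_exp_eq[OF \<delta>] .
  qed
qed

end
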